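(* Let $r_{max}$ be the maximum candidate position range of an election $(\Pi,\mathcal{C})$. There exists a fixed-parameter (dynamic programming) algorithm for \textsc{Distinct OPT Kemeny Ranking Aggregation} parameterized by $r_{max}$ which runs in time $O^*(32^{r_{max}})$.
   Context: Let $\mathcal{C}$ be a set of candidates and $\Pi$ a multiset of rankings (complete linear orders) of $\mathcal{C}$. For a ranking $\pi$ and candidate $c$, $\mathrm{pos}_\pi(c)=|\{c'\in\mathcal{C}: c'\succ_\pi c\}|$. The range of $c$ in $\Pi$ is $\max_{\pi_i,\pi_j\in\Pi}|\mathrm{pos}_{\pi_i}(c)-\mathrm{pos}_{\pi_j}(c)|+1$, and $r_{max}$ is the maximum range over all candidates. The Kendall-Tau distance $d_{KT}(\pi,\sigma)$ is the number of pairs of candidates that two rankings order differently. The Kemeny score of a ranking $Q$ is $\mathrm{Kemeny}_\Pi(Q)=\sum_{\pi\in\Pi} d_{KT}(Q,\pi)$; a Kemeny ranking minimizes it, and $K(\Pi)$ is the set of Kemeny rankings. \textsc{Distinct OPT Kemeny Ranking Aggregation}: given $(\mathcal{C},\Pi,r)$ with integer $r$, output $\min\{r,|K(\Pi)|\}$ distinct Kemeny rankings. $O^*(g)$ denotes $O(g\cdot \mathrm{poly}(\text{input size}))$.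
   Formalization: The integer r is counted in unary in the input size, so the polynomial factor may depend on r; with r in binary the bound fails, since r_max = 2 already allows 2^(n/2) Kemeny rankings to be output. Candidates and votes are nonempty. *)

theory Defs
  imports
    "HOL-Library.Multiset"
    "HOL-Computational_Algebra.Polynomial"
begin

section \<open>Elections and Kemeny rankings\<close>

text \<open>
  A ranking of \<open>C\<close> is a relation \<open>\<pi>\<close> with \<open>linear_order_on C \<pi>\<close>; \<open>(a, b) \<in> \<pi>\<close> means
  that \<open>a\<close> equals \<open>b\<close> or is ranked above \<open>b\<close>.
\<close>

definition above :: "'c rel \<Rightarrow> 'c \<Rightarrow> 'c \<Rightarrow> bool" where
  "above \<pi> a b \<longleftrightarrow> (a, b) \<in> \<pi> \<and> a \<noteq> b"

definition pos :: "'c set \<Rightarrow> 'c rel \<Rightarrow> 'c \<Rightarrow> nat" where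
  "pos C \<pi> c = card {c' \<in> C. above \<pi> c' c}"

text \<open>
  Nonemptiness of \<open>C\<close> and \<open>\<Pi>\<close> is what makes the two maxima below well-defined
  (\<open>Max {}\<close> is unspecified).
\<close>

definition election :: "'c set \<Rightarrow> 'c rel multiset \<Rightarrow> bool" where
  "election C \<Pi> \<longleftrightarrow>
     finite C \<and> C \<noteq> {} \<and> \<Pi> \<noteq> {#} \<and> (\<forall>\<pi>. \<pi> \<in># \<Pi> \<longrightarrow> linear_order_on C \<pi>)"

definition cand_range :: "'c set \<Rightarrow> 'c rel multiset \<Rightarrow> 'c \<Rightarrow> nat" where
  "cand_range C \<Pi> c =
     Max {nat \<bar>int (pos C \<pi> c) - int (pos C \<sigma> c)\<bar> | \<pi> \<sigma>. \<pi> \<in># \<Pi> \<and> \<sigma> \<in># \<Pi>} + 1"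

definition max_range :: "'c set \<Rightarrow> 'c rel multiset \<Rightarrow> nat" where
  "max_range C \<Pi> = Max (cand_range C \<Pi> ` C)"

text \<open>
  Each unordered pair on which the rankings disagree is counted once, as the ordered pair
  listed the way \<open>\<pi>\<close> orders it.
\<close>

definition kt_dist :: "'c set \<Rightarrow> 'c rel \<Rightarrow> 'c rel \<Rightarrow> nat" where
  "kt_dist C \<pi> \<sigma> = card {(a, b). a \<in> C \<and> b \<in> C \<and> above \<pi> a b \<and> above \<sigma> b a}"

definition kemeny_score :: "'c set \<Rightarrow> 'c rel multiset \<Rightarrow> 'c rel \<Rightarrow> nat" where
  "kemeny_score C \<Pi> Q = (\<Sum>\<pi>\<in>#\<Pi>. kt_dist C Q \<pi>)"

definition kemeny_rankings :: "'c set \<Rightarrow> 'c rel multiset \<Rightarrow> 'c rel set" where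
  "kemeny_rankings C \<Pi> = {Q. is_arg_min (kemeny_score C \<Pi>) (linear_order_on C) Q}"


section \<open>Model of computation\<close>

text \<open>
  Algorithms are programs of a first-order, call-by-value functional language over binary trees
  with natural numbers at the leaves, under a uniform cost measure: evaluating an expression node
  costs one step on top of the cost of its subexpressions. A call creates a new environment whose
  length is fixed by the program text, a pair is allocated in one step, and the only arithmetic is
  addition, truncated subtraction and comparison (no multiplication), so that the bit length of a
  number grows by at most one per step. The model is therefore polynomially
  equivalent to Turing machines and to random access machines.
\<close>

datatype val = Num nat | Cell val val

datatype expr =
    EVar nat
  | ENum nat
  | EAdd expr expr
  | ESub expr expr
  | ELe expr expr
  | ECell expr expr
  | EHead expr
  | ETail expr
  | EIf expr expr expr
  | ELet expr expr
  | ECall nat "expr list"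

text \<open>
  The \<open>f\<close>-th entry of a program is the body of function \<open>f\<close>. Environments are lists of values,
  with variables as de Bruijn indices; the environment of a function body is the list of arguments.
\<close>

type_synonym program = "expr list"

text \<open>
  \<open>eval P \<rho> e v t\<close>: in environment \<open>\<rho>\<close> the expression \<open>e\<close> evaluates to \<open>v\<close> in exactly \<open>t\<close> steps.
  A type error (such as the head of a number) or an unbound index has no derivation.
\<close>

inductive
  eval :: "program \<Rightarrow> val list \<Rightarrow> expr \<Rightarrow> val \<Rightarrow> nat \<Rightarrow> bool" and
  evals :: "program \<Rightarrow> val list \<Rightarrow> expr list \<Rightarrow> val list \<Rightarrow> nat \<Rightarrow> bool"
  for P :: program
where
  eval_Var: "i < length \<rho> \<Longrightarrow> eval P \<rho> (EVar i) (\<rho> ! i) 1"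
| eval_Num: "eval P \<rho> (ENum n) (Num n) 1"
| eval_Add: "eval P \<rho> a (Num m) s \<Longrightarrow> eval P \<rho> b (Num n) t \<Longrightarrow>
    eval P \<rho> (EAdd a b) (Num (m + n)) (s + t + 1)"
| eval_Sub: "eval P \<rho> a (Num m) s \<Longrightarrow> eval P \<rho> b (Num n) t \<Longrightarrow>
    eval P \<rho> (ESub a b) (Num (m - n)) (s + t + 1)"
| eval_Le: "eval P \<rho> a (Num m) s \<Longrightarrow> eval P \<rho> b (Num n) t \<Longrightarrow>
    eval P \<rho> (ELe a b) (Num (if m \<le> n then 1 else 0)) (s + t + 1)"
| eval_Cell: "eval P \<rho> a v s \<Longrightarrow> eval P \<rho> b w t \<Longrightarrow>
    eval P \<rho> (ECell a b) (Cell v w) (s + t + 1)"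
| eval_Head: "eval P \<rho> a (Cell v w) t \<Longrightarrow> eval P \<rho> (EHead a) v (t + 1)"
| eval_Tail: "eval P \<rho> a (Cell v w) t \<Longrightarrow> eval P \<rho> (ETail a) w (t + 1)"
| eval_If_true: "eval P \<rho> a u s \<Longrightarrow> u \<noteq> Num 0 \<Longrightarrow> eval P \<rho> b v t \<Longrightarrow>
    eval P \<rho> (EIf a b c) v (s + t + 1)"
| eval_If_false: "eval P \<rho> a (Num 0) s \<Longrightarrow> eval P \<rho> c v t \<Longrightarrow>
    eval P \<rho> (EIf a b c) v (s + t + 1)"
| eval_Let: "eval P \<rho> a u s \<Longrightarrow> eval P (u # \<rho>) b v t \<Longrightarrow>
    eval P \<rho> (ELet a b) v (s + t + 1)"
| eval_Call: "evals P \<rho> as us s \<Longrightarrow> f < length P \<Longrightarrow> eval P us (P ! f) v t \<Longrightarrow>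
    eval P \<rho> (ECall f as) v (s + t + 1)"
| evals_Nil: "evals P \<rho> [] [] 0"
| evals_Cons: "eval P \<rho> a v s \<Longrightarrow> evals P \<rho> as vs t \<Longrightarrow>
    evals P \<rho> (a # as) (v # vs) (s + t)"

inductive_cases eval_elims:
  "eval P \<rho> (EVar i) v t" "eval P \<rho> (ENum n) v t" "eval P \<rho> (EAdd a b) v t"
  "eval P \<rho> (ESub a b) v t" "eval P \<rho> (ELe a b) v t" "eval P \<rho> (ECell a b) v t"
  "eval P \<rho> (EHead a) v t" "eval P \<rho> (ETail a) v t" "eval P \<rho> (EIf a b c) v t"
  "eval P \<rho> (ELet a b) v t" "eval P \<rho> (ECall f as) v t"
inductive_cases evals_elims:
  "evals P \<rho> [] vs t" "evals P \<rho> (a # as) vs t"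

lemma eval_deterministic:
  "eval P \<rho> e v t \<Longrightarrow> eval P \<rho> e v' t' \<Longrightarrow> v' = v \<and> t' = t"
  and evals_deterministic:
  "evals P \<rho> es vs t \<Longrightarrow> evals P \<rho> es vs' t' \<Longrightarrow> vs' = vs \<and> t' = t"
proof (induction arbitrary: v' t' and vs' t' rule: eval_evals.inducts)
  case eval_Var then show ?case by (auto elim: eval_elims(1))
next
  case eval_Num then show ?case by (auto elim: eval_elims(2))
next
  case eval_Add show ?case
    by (rule eval_elims(3)[OF eval_Add.prems]; auto dest!: eval_Add.IH(2,4))
next
  case eval_Sub show ?case
    by (rule eval_elims(4)[OF eval_Sub.prems]; auto dest!: eval_Sub.IH(2,4))
next
  case eval_Le show ?case
    by (rule eval_elims(5)[OF eval_Le.prems]; auto dest!: eval_Le.IH(2,4))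
next
  case eval_Cell show ?case
    by (rule eval_elims(6)[OF eval_Cell.prems]; auto dest!: eval_Cell.IH(2,4))
next
  case eval_Head show ?case
    by (rule eval_elims(7)[OF eval_Head.prems]; auto dest!: eval_Head.IH(2))
next
  case eval_Tail show ?case
    by (rule eval_elims(8)[OF eval_Tail.prems]; auto dest!: eval_Tail.IH(2))
next
  case eval_If_true show ?case
    by (rule eval_elims(9)[OF eval_If_true.prems]; use eval_If_true.hyps in \<open>auto dest!: eval_If_true.IH(2,4)\<close>)
next
  case eval_If_false show ?case
    by (rule eval_elims(9)[OF eval_If_false.prems]; auto dest!: eval_If_false.IH(2,4))
next
  case eval_Let show ?case
    by (rule eval_elims(10)[OF eval_Let.prems]; auto dest!: eval_Let.IH(2,4))
next
  case eval_Call show ?case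
    by (rule eval_elims(11)[OF eval_Call.prems]; auto dest!: eval_Call.IH(2,5))
next
  case evals_Nil then show ?case by (auto elim: evals_elims(1))
next
  case evals_Cons show ?case
    by (rule evals_elims(2)[OF evals_Cons.prems]; auto dest!: evals_Cons.IH(2,4))
qed

definition runs :: "program \<Rightarrow> val \<Rightarrow> val \<Rightarrow> nat \<Rightarrow> bool" where
  "runs P inp out t \<longleftrightarrow> eval P [inp] (ECall 0 [EVar 0]) out t"

primrec val_size :: "val \<Rightarrow> nat" where
  "val_size (Num n) = 1"
| "val_size (Cell v w) = val_size v + val_size w + 1"


section \<open>Distinct OPT Kemeny Ranking Aggregation\<close>

primrec enc_list :: "('a \<Rightarrow> val) \<Rightarrow> 'a list \<Rightarrow> val" where
  "enc_list f [] = Num 0"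
| "enc_list f (x # xs) = Cell (f x) (enc_list f xs)"

definition order_of_list :: "'c list \<Rightarrow> 'c rel" where
  "order_of_list xs = {(xs ! i, xs ! j) | i j. i \<le> j \<and> j < length xs}"

lemma order_of_list_Nil [simp]: "order_of_list [] = {}"
  by (simp add: order_of_list_def)

lemma order_of_list_Cons:
  "order_of_list (x # xs) = {x} \<times> set (x # xs) \<union> order_of_list xs"
proof (intro set_eqI iffI)
  fix p assume "p \<in> order_of_list (x # xs)"
  then obtain i j where p: "p = ((x # xs) ! i, (x # xs) ! j)" "i \<le> j" "j < length (x # xs)"
    by (auto simp: order_of_list_def)
  show "p \<in> {x} \<times> set (x # xs) \<union> order_of_list xs"
  proof (cases i)
    case 0
    then show ?thesis using p nth_mem[of j "x # xs"] by auto
  next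
    case (Suc i')
    then obtain j' where "j = Suc j'" using p(2) by (cases j) auto
    then show ?thesis using p Suc by (auto simp: order_of_list_def)
  qed
next
  fix p assume "p \<in> {x} \<times> set (x # xs) \<union> order_of_list xs"
  then consider (head) y where "p = (x, y)" "y \<in> set (x # xs)" | (tail) "p \<in> order_of_list xs"
    by auto
  then show "p \<in> order_of_list (x # xs)"
  proof cases
    case head
    then obtain j where "j < length (x # xs)" "(x # xs) ! j = y" by (metis in_set_conv_nth)
    then show ?thesis using head(1) unfolding order_of_list_def
      by (intro CollectI exI[of _ 0] exI[of _ j]) auto
  next
    case tail
    then obtain i j where "p = (xs ! i, xs ! j)" "i \<le> j" "j < length xs"
      by (auto simp: order_of_list_def)
    then show ?thesis unfolding order_of_list_def
      by (intro CollectI exI[of _ "Suc i"] exI[of _ "Suc j"]) auto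
  qed
qed

lemma order_of_list_subset: "order_of_list xs \<subseteq> set xs \<times> set xs"
  by (auto simp: order_of_list_def)

lemma linear_order_on_order_of_list:
  "distinct xs \<Longrightarrow> linear_order_on (set xs) (order_of_list xs)"
proof (induction xs)
  case Nil
  then show ?case by simp
next
  case (Cons x xs)
  then have lin: "linear_order_on (set xs) (order_of_list xs)" and x: "x \<notin> set xs" by auto
  have sub: "order_of_list xs \<subseteq> set xs \<times> set xs" by (rule order_of_list_subset)
  have "trans (order_of_list (x # xs))"
    using lin sub x unfolding order_of_list_Cons order_on_defs trans_def by auto
  moreover have "antisym (order_of_list (x # xs))"
    using lin sub x unfolding order_of_list_Cons order_on_defs antisym_def by auto
  moreover have "total_on (set (x # xs)) (order_of_list (x # xs))"
    using lin unfolding order_of_list_Cons order_on_defs total_on_def by auto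
  moreover have "refl_on (set (x # xs)) (order_of_list (x # xs))"
    using lin unfolding order_of_list_Cons order_on_defs refl_on_def by auto
  ultimately show ?case
    using order_of_list_subset[of "x # xs"] unfolding order_on_defs by blast
qed

lemma ranking_has_list:
  assumes "finite C" "linear_order_on C \<pi>"
  shows "\<exists>xs. distinct xs \<and> set xs = C \<and> order_of_list xs = \<pi>"
  using assms
proof (induction "card C" arbitrary: C \<pi>)
  case 0
  then have "C = {}" by simp
  moreover from this 0 have "\<pi> = {}" by (auto simp: order_on_defs)
  ultimately show ?case by (intro exI[of _ "[]"]) auto
next
  case (Suc n)
  then have "finite \<pi>"
    by (auto simp: order_on_defs intro: finite_subset[of \<pi> "C \<times> C"])
  have "well_order_on C \<pi>"
    using linear_order_on_well_order_on[OF \<open>finite \<pi>\<close>] Suc.prems(2) by blast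
  then have wf: "wf (\<pi> - Id)" by (simp only: well_order_on_def)
  have "C \<noteq> {}" using Suc.hyps(2) by auto
  then obtain x where x: "x \<in> C" "\<And>y. (y, x) \<in> \<pi> - Id \<Longrightarrow> y \<notin> C"
    using wf by (metis wfE_min')
  define \<sigma> where "\<sigma> = \<pi> \<inter> (C - {x}) \<times> (C - {x})"
  have ord: "\<pi> \<subseteq> C \<times> C" "refl_on C \<pi>" "trans \<pi>" "antisym \<pi>" "total_on C \<pi>"
    using Suc.prems(2) by (auto simp: order_on_defs)
  have "\<sigma> \<subseteq> (C - {x}) \<times> (C - {x})" by (auto simp: \<sigma>_def)
  moreover have "refl_on (C - {x}) \<sigma>" using ord(2) by (auto simp: \<sigma>_def refl_on_def)
  moreover have "trans \<sigma>"
    using ord(3) unfolding \<sigma>_def by (intro trans_Int) (auto intro!: transI)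
  moreover have "antisym \<sigma>" using ord(4) unfolding \<sigma>_def by (rule antisym_subset[rotated]) auto
  moreover have "total_on (C - {x}) \<sigma>" using ord(5) by (auto simp: \<sigma>_def total_on_def)
  ultimately have lin: "linear_order_on (C - {x}) \<sigma>" by (simp add: order_on_defs)
  have "n = card (C - {x})" "finite (C - {x})"
    using Suc.hyps(2) Suc.prems(1) x(1) by auto
  from Suc.hyps(1)[OF this lin] obtain xs where
    xs: "distinct xs" "set xs = C - {x}" "order_of_list xs = \<sigma>" by blast
  have sub: "\<pi> \<subseteq> C \<times> C" and refl: "\<And>y. y \<in> C \<Longrightarrow> (y, y) \<in> \<pi>"
    and tot: "\<And>y z. y \<in> C \<Longrightarrow> z \<in> C \<Longrightarrow> y \<noteq> z \<Longrightarrow> (y, z) \<in> \<pi> \<or> (z, y) \<in> \<pi>"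
    using Suc.prems(2) by (auto simp: order_on_defs refl_on_def total_on_def)
  have top: "(x, y) \<in> \<pi>" if "y \<in> C" for y
    using tot[OF x(1) that] refl[OF x(1)] x(2)[of y] that by auto
  have "order_of_list (x # xs) = \<pi>"
  proof
    show "order_of_list (x # xs) \<subseteq> \<pi>"
      using top x(1) xs by (auto simp: order_of_list_Cons \<sigma>_def)
    show "\<pi> \<subseteq> order_of_list (x # xs)"
      using sub x xs by (auto simp: order_of_list_Cons \<sigma>_def)
  qed
  then show ?case using xs x(1) by (intro exI[of _ "x # xs"]) auto
qed

text \<open>Candidates are named by natural numbers; a ranking is listed from top to bottom.\<close>

definition enc_ranking :: "nat list \<Rightarrow> val" where
  "enc_ranking xs = enc_list Num xs"

text \<open>
  The number \<open>r\<close> is given in unary, as a list of length \<open>r\<close>, so that it contributes \<open>r\<close> to the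
  input size: \<open>|K(\<Pi>)|\<close> can be exponential in \<open>|C|\<close> already when the maximum range is 2, so merely
  writing \<open>min r |K(\<Pi>)|\<close> rankings is not polynomial in the bit length of \<open>r\<close>.
\<close>

definition encodes_instance :: "nat set \<Rightarrow> nat rel multiset \<Rightarrow> nat \<Rightarrow> val \<Rightarrow> bool" where
  "encodes_instance C \<Pi> r inp \<longleftrightarrow>
     (\<exists>cs vs. distinct cs \<and> set cs = C \<and>
        (\<forall>xs\<in>set vs. distinct xs \<and> set xs = C) \<and> mset (map order_of_list vs) = \<Pi> \<and>
        inp = Cell (enc_ranking cs)
                (Cell (enc_list enc_ranking vs) (enc_list Num (replicate r 0))))"

lemma encodes_instance_exists:
  assumes "election C \<Pi>"
  shows "\<exists>inp. encodes_instance C \<Pi> r inp"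
proof -
  from assms have fin: "finite C" and lin: "\<And>\<pi>. \<pi> \<in># \<Pi> \<Longrightarrow> linear_order_on C \<pi>"
    by (auto simp: election_def)
  obtain cs where cs: "set cs = C" "distinct cs" using finite_distinct_list[OF fin] by blast
  obtain ps where ps: "mset ps = \<Pi>" using ex_mset by blast
  obtain g where g: "\<And>\<pi>. \<pi> \<in># \<Pi> \<Longrightarrow>
      distinct (g \<pi>) \<and> set (g \<pi>) = C \<and> order_of_list (g \<pi>) = \<pi>"
    using ranking_has_list[OF fin lin] by metis
  have "map order_of_list (map g ps) = ps"
    using g ps by (auto simp: map_idI)
  moreover have "\<forall>xs\<in>set (map g ps). distinct xs \<and> set xs = C"
    using g ps by auto
  ultimately show ?thesis
    unfolding encodes_instance_def using cs ps by metis
qed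

definition encodes_solution :: "nat set \<Rightarrow> nat rel multiset \<Rightarrow> nat \<Rightarrow> val \<Rightarrow> bool" where
  "encodes_solution C \<Pi> r out \<longleftrightarrow>
     (\<exists>ws. (\<forall>w\<in>set ws. distinct w \<and> set w = C) \<and>
        distinct (map order_of_list ws) \<and>
        order_of_list ` set ws \<subseteq> kemeny_rankings C \<Pi> \<and>
        length ws = min r (card (kemeny_rankings C \<Pi>)) \<and>
        out = enc_list enc_ranking ws)"

end

theory Submission
  imports Defs
begin

text \<open>
  If every vote ranks \<open>a\<close> above \<open>b\<close>, then so does every Kemeny ranking, since otherwise exchanging
  \<open>a\<close> and \<open>b\<close> strictly lowers the score. Hence every set of candidates at the bottom of a Kemeny
  ranking is closed under unanimous defeat. Fix one vote \<open>v\<close>. Candidates at least \<open>2 r\<^sub>m\<^sub>a\<^sub>x\<close>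
  positions apart in \<open>v\<close> are ordered the same way by all votes, so a closed set is determined by
  its topmost position in \<open>v\<close> and its trace on a window of \<open>2 r\<^sub>m\<^sub>a\<^sub>x\<close> positions below; there are at
  most \<open>(n + 1) * 4 ^ r\<^sub>m\<^sub>a\<^sub>x\<close> of them. Rankings are built from the bottom: putting \<open>c\<close> on top of a
  closed set costs an amount depending on the set only, so for each closed set it suffices to
  store the optimal cost and up to \<open>r\<close> optimal rankings of it. Looking sets up by linear search
  makes the number of steps quadratic in the number of closed sets, \<open>16 ^ r\<^sub>m\<^sub>a\<^sub>x\<close> up to a polynomial.
\<close>

section \<open>The program\<close>

definition EEq :: "expr \<Rightarrow> expr \<Rightarrow> expr" where
  "EEq a b = EIf (ELe a b) (ELe b a) (ENum 0)"

definition EAnd :: "expr \<Rightarrow> expr \<Rightarrow> expr" where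
  "EAnd a b = EIf a b (ENum 0)"

abbreviation "call_mem x xs \<equiv> ECall 1 [x, xs]"
abbreviation "call_bef a b v \<equiv> ECall 2 [a, b, v]"
abbreviation "call_against a b vs \<equiv> ECall 3 [a, b, vs]"
abbreviation "call_top_cost c S vs \<equiv> ECall 4 [c, S, vs]"
abbreviation "call_admissible as c S vs \<equiv> ECall 5 [as, c, S, vs]"
abbreviation "call_subset xs ys \<equiv> ECall 6 [xs, ys]"
abbreviation "call_take_append r xs ys \<equiv> ECall 7 [r, xs, ys]"
abbreviation "call_map_Cons c Qs \<equiv> ECall 8 [c, Qs]"
abbreviation "call_ins S k Qs L r \<equiv> ECall 9 [S, k, Qs, L, r]"
abbreviation "call_expand ds S k Qs L cs vs r \<equiv> ECall 10 [ds, S, k, Qs, L, cs, vs, r]"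
abbreviation "call_step L acc cs vs r \<equiv> ECall 11 [L, acc, cs, vs, r]"
abbreviation "call_layers ds L cs vs r \<equiv> ECall 12 [ds, L, cs, vs, r]"

definition kemeny_prog :: program where
  "kemeny_prog = [
    \<comment> \<open>0: main [inp]\<close>
    ETail (ETail (EHead (call_layers (EHead (EVar 0))
      (ECell (ECell (ENum 0) (ECell (ENum 0)
        (call_take_append (ETail (ETail (EVar 0))) (ECell (ENum 0) (ENum 0)) (ENum 0)))) (ENum 0))
      (EHead (EVar 0)) (EHead (ETail (EVar 0))) (ETail (ETail (EVar 0)))))),
    \<comment> \<open>1: mem [x, xs]\<close>
    EIf (EVar 1)
      (EIf (EEq (EVar 0) (EHead (EVar 1))) (ENum 1) (call_mem (EVar 0) (ETail (EVar 1))))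
      (ENum 0),
    \<comment> \<open>2: bef [a, b, v]\<close>
    EIf (EVar 2)
      (EIf (EEq (EHead (EVar 2)) (EVar 0)) (ENum 1)
        (EIf (EEq (EHead (EVar 2)) (EVar 1)) (ENum 0)
          (call_bef (EVar 0) (EVar 1) (ETail (EVar 2)))))
      (ENum 0),
    \<comment> \<open>3: against [a, b, vs]\<close>
    EIf (EVar 2)
      (EAdd (call_bef (EVar 1) (EVar 0) (EHead (EVar 2)))
        (call_against (EVar 0) (EVar 1) (ETail (EVar 2))))
      (ENum 0),
    \<comment> \<open>4: top_cost [c, S, vs]\<close>
    EIf (EVar 1)
      (EAdd (call_against (EVar 0) (EHead (EVar 1)) (EVar 2))
        (call_top_cost (EVar 0) (ETail (EVar 1)) (EVar 2)))
      (ENum 0),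
    \<comment> \<open>5: admissible [as, c, S, vs]\<close>
    EIf (EVar 0)
      (EIf (call_mem (EHead (EVar 0)) (EVar 2))
        (call_admissible (ETail (EVar 0)) (EVar 1) (EVar 2) (EVar 3))
        (EIf (call_against (EVar 1) (EHead (EVar 0)) (EVar 3))
          (call_admissible (ETail (EVar 0)) (EVar 1) (EVar 2) (EVar 3))
          (ENum 0)))
      (ENum 1),
    \<comment> \<open>6: subset [xs, ys]\<close>
    EIf (EVar 0)
      (EIf (call_mem (EHead (EVar 0)) (EVar 1)) (call_subset (ETail (EVar 0)) (EVar 1)) (ENum 0))
      (ENum 1),
    \<comment> \<open>7: take_append [r, xs, ys]\<close>
    EIf (EVar 0)
      (EIf (EVar 1)
        (ECell (EHead (EVar 1)) (call_take_append (ETail (EVar 0)) (ETail (EVar 1)) (EVar 2)))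
        (EIf (EVar 2)
          (ECell (EHead (EVar 2)) (call_take_append (ETail (EVar 0)) (EVar 1) (ETail (EVar 2))))
          (ENum 0)))
      (ENum 0),
    \<comment> \<open>8: map_Cons [c, Qs]\<close>
    EIf (EVar 1)
      (ECell (ECell (EVar 0) (EHead (EVar 1))) (call_map_Cons (EVar 0) (ETail (EVar 1))))
      (ENum 0),
    \<comment> \<open>9: ins [S, k, Qs, L, r]\<close>
    EIf (EVar 3)
      (EIf (EAnd (call_subset (EVar 0) (EHead (EHead (EVar 3))))
                 (call_subset (EHead (EHead (EVar 3))) (EVar 0)))
        (EIf (ELe (EVar 1) (EHead (ETail (EHead (EVar 3)))))
          (EIf (ELe (EHead (ETail (EHead (EVar 3)))) (EVar 1))
            (ECell (ECell (EVar 0) (ECell (EVar 1)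
                (call_take_append (EVar 4) (EVar 2) (ETail (ETail (EHead (EVar 3)))))))
              (ETail (EVar 3)))
            (ECell (ECell (EVar 0) (ECell (EVar 1) (EVar 2))) (ETail (EVar 3))))
          (EVar 3))
        (ECell (EHead (EVar 3)) (call_ins (EVar 0) (EVar 1) (EVar 2) (ETail (EVar 3)) (EVar 4))))
      (ECell (ECell (EVar 0) (ECell (EVar 1) (EVar 2))) (ENum 0)),
    \<comment> \<open>10: expand [ds, S, k, Qs, L, cs, vs, r]\<close>
    EIf (EVar 0)
      (call_expand (ETail (EVar 0)) (EVar 1) (EVar 2) (EVar 3)
        (EIf (call_mem (EHead (EVar 0)) (EVar 1))
          (EVar 4)
          (EIf (call_admissible (EVar 5) (EHead (EVar 0)) (EVar 1) (EVar 6))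
            (call_ins (ECell (EHead (EVar 0)) (EVar 1))
              (EAdd (EVar 2) (call_top_cost (EHead (EVar 0)) (EVar 1) (EVar 6)))
              (call_map_Cons (EHead (EVar 0)) (EVar 3)) (EVar 4) (EVar 7))
            (EVar 4)))
        (EVar 5) (EVar 6) (EVar 7))
      (EVar 4),
    \<comment> \<open>11: step [L, acc, cs, vs, r]\<close>
    EIf (EVar 0)
      (call_step (ETail (EVar 0))
        (call_expand (EVar 2) (EHead (EHead (EVar 0))) (EHead (ETail (EHead (EVar 0))))
          (ETail (ETail (EHead (EVar 0)))) (EVar 1) (EVar 2) (EVar 3) (EVar 4))
        (EVar 2) (EVar 3) (EVar 4))
      (EVar 1),
    \<comment> \<open>12: layers [ds, L, cs, vs, r]\<close>
    EIf (EVar 0)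
      (call_layers (ETail (EVar 0)) (call_step (EVar 1) (ENum 0) (EVar 2) (EVar 3) (EVar 4))
        (EVar 2) (EVar 3) (EVar 4))
      (EVar 1)]"

section \<open>Bounded evaluation\<close>

definition ev :: "val list \<Rightarrow> expr \<Rightarrow> val \<Rightarrow> nat \<Rightarrow> bool" where
  "ev \<rho> e v T \<longleftrightarrow> (\<exists>t\<le>T. eval kemeny_prog \<rho> e v t)"

definition evs :: "val list \<Rightarrow> expr list \<Rightarrow> val list \<Rightarrow> nat \<Rightarrow> bool" where
  "evs \<rho> es vs T \<longleftrightarrow> (\<exists>t\<le>T. evals kemeny_prog \<rho> es vs t)"

definition fn :: "nat \<Rightarrow> val list \<Rightarrow> val \<Rightarrow> nat \<Rightarrow> bool" where
  "fn f us v T \<longleftrightarrow> f < length kemeny_prog \<and> ev us (kemeny_prog ! f) v T"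

lemma ev_conv: "ev \<rho> e v s \<Longrightarrow> v = w \<Longrightarrow> s \<le> T \<Longrightarrow> ev \<rho> e w T"
  unfolding ev_def by (meson le_trans)

lemma fn_conv: "fn f us v s \<Longrightarrow> v = w \<Longrightarrow> s \<le> T \<Longrightarrow> fn f us w T"
  unfolding fn_def by (meson ev_conv)

lemma ev_nth: "i < length \<rho> \<Longrightarrow> \<rho> ! i = v \<Longrightarrow> ev \<rho> (EVar i) v 1"
  unfolding ev_def using eval_Var[of i \<rho>] by blast

lemma ev_Var:
  "ev (a0 # \<rho>) (EVar 0) a0 1"
  "ev (a0 # a1 # \<rho>) (EVar (Suc 0)) a1 1"
  "ev (a0 # a1 # a2 # \<rho>) (EVar 2) a2 1"
  "ev (a0 # a1 # a2 # a3 # \<rho>) (EVar 3) a3 1"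
  "ev (a0 # a1 # a2 # a3 # a4 # \<rho>) (EVar 4) a4 1"
  "ev (a0 # a1 # a2 # a3 # a4 # a5 # \<rho>) (EVar 5) a5 1"
  "ev (a0 # a1 # a2 # a3 # a4 # a5 # a6 # \<rho>) (EVar 6) a6 1"
  "ev (a0 # a1 # a2 # a3 # a4 # a5 # a6 # a7 # \<rho>) (EVar 7) a7 1"
  by (rule ev_nth; simp)+

lemma ev_Num: "ev \<rho> (ENum n) (Num n) 1"
  unfolding ev_def using eval_Num by blast

lemma evD: "ev \<rho> e v T \<Longrightarrow> \<exists>t\<le>T. eval kemeny_prog \<rho> e v t"
  by (simp add: ev_def)

lemma evI: "eval kemeny_prog \<rho> e v t \<Longrightarrow> t \<le> T \<Longrightarrow> ev \<rho> e v T"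
  by (auto simp: ev_def)

lemma ev_Add: "ev \<rho> a (Num m) s \<Longrightarrow> ev \<rho> b (Num n) t \<Longrightarrow> ev \<rho> (EAdd a b) (Num (m + n)) (s + t + 1)"
  by (auto dest!: evD intro!: evI[OF eval_Add])

lemma ev_Le: "ev \<rho> a (Num m) s \<Longrightarrow> ev \<rho> b (Num n) t \<Longrightarrow>
    ev \<rho> (ELe a b) (Num (of_bool (m \<le> n))) (s + t + 1)"
  unfolding of_bool_def by (drule evD, drule evD, elim exE conjE) (rule evI[OF eval_Le], auto)

lemma ev_Cell: "ev \<rho> a v s \<Longrightarrow> ev \<rho> b w t \<Longrightarrow> ev \<rho> (ECell a b) (Cell v w) (s + t + 1)"
  by (auto dest!: evD intro!: evI[OF eval_Cell])

lemma ev_Head: "ev \<rho> a (Cell v w) t \<Longrightarrow> ev \<rho> (EHead a) v (t + 1)"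
  by (auto dest!: evD intro!: evI[OF eval_Head])

lemma ev_Tail: "ev \<rho> a (Cell v w) t \<Longrightarrow> ev \<rho> (ETail a) w (t + 1)"
  by (auto dest!: evD intro!: evI[OF eval_Tail])

lemma ev_If: "ev \<rho> a u s \<Longrightarrow> (if u \<noteq> Num 0 then ev \<rho> b v t else ev \<rho> c v t) \<Longrightarrow>
    ev \<rho> (EIf a b c) v (s + t + 1)"
  by (cases "u = Num 0")
     (auto dest!: evD intro: evI[OF eval_If_true] evI[OF eval_If_false])

lemma ev_Eq:
  assumes "ev \<rho> a (Num m) s" "ev \<rho> b (Num n) t"
  shows "ev \<rho> (EEq a b) (Num (of_bool (m = n))) (2 * s + 2 * t + 4)"
proof (cases "m \<le> n")
  case True
  show ?thesis unfolding EEq_def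
    by (rule ev_conv, rule ev_If, rule ev_Le, rule assms(1), rule assms(2))
       (use True ev_Le[OF assms(2,1)] in auto)
next
  case False
  show ?thesis unfolding EEq_def
    by (rule ev_conv, rule ev_If, rule ev_Le, rule assms(1), rule assms(2))
       (use False ev_Num[of \<rho> 0] in auto)
qed

lemma ev_And:
  assumes "ev \<rho> a (Num (of_bool p)) s" "ev \<rho> b (Num (of_bool q)) t"
  shows "ev \<rho> (EAnd a b) (Num (of_bool (p \<and> q))) (s + t + 2)"
proof (cases p)
  case True
  show ?thesis unfolding EAnd_def
    by (rule ev_conv, rule ev_If, rule assms(1)) (use True assms(2) in auto)
next
  case False
  show ?thesis unfolding EAnd_def
    by (rule ev_conv, rule ev_If, rule assms(1)) (use False ev_Num[of \<rho> 0] in auto)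
qed

lemma evs_Nil: "evs \<rho> [] [] 0"
  unfolding evs_def using evals_Nil by blast

lemma evs_Cons: "ev \<rho> a v s \<Longrightarrow> evs \<rho> as vs t \<Longrightarrow> evs \<rho> (a # as) (v # vs) (s + t)"
  unfolding ev_def evs_def by (meson add_le_mono evals_Cons)

lemma ev_Call: "evs \<rho> as us s \<Longrightarrow> fn f us v t \<Longrightarrow> ev \<rho> (ECall f as) v (s + t + 1)"
  unfolding ev_def evs_def fn_def by (meson add_le_mono eval_Call order_refl)

lemmas ev_intros = ev_Var ev_Num ev_Eq ev_And ev_Add ev_Le ev_Cell ev_Head ev_Tail ev_If evs_Nil evs_Cons ev_Call

lemma fn_intro:
  "f < 13 \<Longrightarrow> ev us (kemeny_prog ! f) v s \<Longrightarrow> v = w \<Longrightarrow> s \<le> T \<Longrightarrow> fn f us w T"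
  unfolding fn_def by (auto simp: kemeny_prog_def intro: ev_conv)

section \<open>Values and running times of the functions\<close>

lemma enc_ranking_simps [simp]:
  "enc_ranking [] = Num 0" "enc_ranking (x # xs) = Cell (Num x) (enc_ranking xs)"
  by (simp_all add: enc_ranking_def)

text \<open>
  \<open>bef a a v\<close> holds for every \<open>a\<close> in \<open>v\<close>, so \<open>against vs c c\<close> below is the number of votes;
  \<open>admissible\<close> relies on this being nonzero when \<open>a = c\<close>.
\<close>

primrec bef :: "'c \<Rightarrow> 'c \<Rightarrow> 'c list \<Rightarrow> bool" where
  "bef a b [] = False"
| "bef a b (x # v) = (x = a \<or> x \<noteq> b \<and> bef a b v)"

definition against :: "'c list list \<Rightarrow> 'c \<Rightarrow> 'c \<Rightarrow> nat" where
  "against vs a b = length (filter (bef b a) vs)"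

definition top_cost :: "'c list list \<Rightarrow> 'c \<Rightarrow> 'c list \<Rightarrow> nat" where
  "top_cost vs c S = (\<Sum>b\<leftarrow>S. against vs c b)"

definition admissible :: "'c list list \<Rightarrow> 'c set \<Rightarrow> 'c \<Rightarrow> 'c set \<Rightarrow> bool" where
  "admissible vs C c X \<longleftrightarrow> (\<forall>a\<in>C. a \<in> X \<or> against vs c a \<noteq> 0)"

lemma fn_mem: "fn (Suc 0) [Num x, enc_ranking xs] (Num (of_bool (x \<in> set xs))) ((length xs + 1) * 30)"
proof (induction xs)
  case Nil
  show ?case
    by (rule fn_intro, simp, simp add: kemeny_prog_def, (rule ev_intros | simp)+)
next
  case (Cons y xs)
  show ?case
    by (cases "x = y"; (rule fn_intro, simp, simp add: kemeny_prog_def,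
        (rule ev_intros Cons.IH | simp)+))
qed

lemma fn_bef: "fn 2 [Num a, Num b, enc_ranking v] (Num (of_bool (bef a b v))) ((length v + 1) * 50)"
proof (induction v)
  case Nil
  show ?case
    by (rule fn_intro, simp, simp add: kemeny_prog_def, (rule ev_intros | simp)+)
next
  case (Cons y v)
  show ?case
    by (cases "y = a"; cases "y = b"; (rule fn_intro, simp, simp add: kemeny_prog_def,
        (rule ev_intros Cons.IH | simp)+))
qed

lemma fn_against:
  assumes "\<forall>v\<in>set vs. length v + 1 \<le> z"
  shows "fn 3 [Num a, Num b, enc_list enc_ranking vs] (Num (against vs a b)) ((length vs + 1) * (50 * z + 20))"
  using assms
proof (induction vs)
  case Nil
  show ?case
    by (rule fn_intro, simp, simp add: kemeny_prog_def, (rule ev_intros | simp add: against_def)+)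
next
  case (Cons v vs)
  then have v: "length v + 1 \<le> z" and vs: "\<forall>v\<in>set vs. length v + 1 \<le> z" by simp_all
  show ?case
    by (rule fn_intro, simp, simp add: kemeny_prog_def, (rule ev_intros Cons.IH[OF vs] fn_bef | simp)+)
      (use v in \<open>simp_all add: against_def\<close>)
qed

lemma fn_top_cost:
  assumes "\<forall>v\<in>set vs. length v + 1 \<le> z" "length vs + 1 \<le> z"
  shows "fn 4 [Num c, enc_ranking S, enc_list enc_ranking vs] (Num (top_cost vs c S))
    ((length S + 1) * (z * (50 * z + 20) + 20))"
proof (induction S)
  case Nil
  show ?case
    by (rule fn_intro, simp, simp add: kemeny_prog_def, (rule ev_intros | simp add: top_cost_def)+)
next
  case (Cons b S)
  have "(length vs + 1) * (50 * z + 20) \<le> z * (50 * z + 20)" using assms(2) by (rule mult_le_mono1)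
  then show ?case
    by (intro fn_intro, simp, simp add: kemeny_prog_def)
       ((rule ev_intros Cons.IH fn_against[OF assms(1)] | simp)+, simp_all add: top_cost_def)
qed

lemma fn_admissible:
  assumes "\<forall>v\<in>set vs. length v + 1 \<le> z" "length vs + 1 \<le> z" "length S + 1 \<le> z"
  shows "fn 5 [enc_ranking as, Num c, enc_ranking S, enc_list enc_ranking vs]
    (Num (of_bool (admissible vs (set as) c (set S)))) ((length as + 1) * (z * (50 * z + 50) + 30))"
proof (induction "as")
  case Nil
  show ?case
    by (rule fn_intro, simp, simp add: kemeny_prog_def, (rule ev_intros | simp add: admissible_def)+)
next
  case (Cons a as)
  define B where "B = z * (50 * z + 20)"
  note ag = fn_conv[OF fn_against[OF assms(1)] refl, OF mult_le_mono1[OF assms(2)], folded B_def]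
  note mem = fn_conv[OF fn_mem refl, OF mult_le_mono1[OF assms(3)]]
  have eq: "z * (50 * z + 50) = B + z * 30" by (simp add: B_def algebra_simps)
  note IH = Cons.IH[unfolded eq]
  have "fn 5 [enc_ranking (a # as), Num c, enc_ranking S, enc_list enc_ranking vs]
    (Num (of_bool (admissible vs (set (a # as)) c (set S)))) ((length (a # as) + 1) * (B + z * 30 + 30))"
    by (cases "a \<in> set S"; cases "against vs c a = 0"; (rule fn_intro, simp, simp add: kemeny_prog_def,
       (rule ev_intros IH ag mem | simp add: admissible_def)+))
  then show ?case unfolding eq .
qed

lemma fn_subset:
  assumes "length ys + 1 \<le> z"
  shows "fn 6 [enc_ranking xs, enc_ranking ys] (Num (of_bool (set xs \<subseteq> set ys)))
    ((length xs + 1) * (z * 30 + 20))"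
proof (induction xs)
  case Nil
  show ?case
    by (rule fn_intro, simp, simp add: kemeny_prog_def, (rule ev_intros | simp)+)
next
  case (Cons x xs)
  note mem = fn_conv[OF fn_mem refl, OF mult_le_mono1[OF assms]]
  show ?case
    by (cases "x \<in> set ys"; (rule fn_intro, simp, simp add: kemeny_prog_def,
       (rule ev_intros Cons.IH mem | simp)+))
qed

lemma fn_take_append:
  "fn 7 [enc_list Num (replicate r 0), enc_list f xs, enc_list f ys]
    (enc_list f (take r (xs @ ys))) ((r + 1) * 30)"
proof (induction r arbitrary: xs ys)
  case 0
  show ?case
    by (rule fn_intro, simp, simp add: kemeny_prog_def, (rule ev_intros | simp)+)
next
  case (Suc r)
  have IH3: "fn 7 [enc_list Num (replicate r 0), enc_list f us, Cell (f w) (enc_list f ws)]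
    (enc_list f (take r (us @ w # ws))) ((r + 1) * 30)" for us w ws
    using Suc.IH[of us "w # ws"] by simp
  note IH = Suc.IH Suc.IH[of "[]", simplified] Suc.IH[of _ "[]", simplified] IH3
  show ?case
    by (cases xs; cases ys; (rule fn_intro, simp, simp add: kemeny_prog_def,
       (rule ev_intros IH | simp)+))
qed

lemma fn_map_Cons:
  "fn 8 [Num c, enc_list enc_ranking Qs] (enc_list enc_ranking (map (Cons c) Qs)) ((length Qs + 1) * 30)"
proof (induction Qs)
  case Nil
  show ?case
    by (rule fn_intro, simp, simp add: kemeny_prog_def, (rule ev_intros | simp)+)
next
  case (Cons Q Qs)
  show ?case
    by (rule fn_intro, simp, simp add: kemeny_prog_def, (rule ev_intros Cons.IH | simp)+)
qed

type_synonym entry = "nat list \<times> nat \<times> nat list list"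

fun enc_entry :: "entry \<Rightarrow> val" where
  "enc_entry (S, k, Qs) = Cell (enc_ranking S) (Cell (Num k) (enc_list enc_ranking Qs))"

fun ins :: "nat \<Rightarrow> entry \<Rightarrow> entry list \<Rightarrow> entry list" where
  "ins r e [] = [e]"
| "ins r (S, k, Qs) ((S', k', Qs') # L) =
    (if set S = set S' then
       (if k < k' then (S, k, Qs) # L
        else if k' < k then (S', k', Qs') # L
        else (S, k, take r (Qs @ Qs')) # L)
     else (S', k', Qs') # ins r (S, k, Qs) L)"

fun small :: "nat \<Rightarrow> entry \<Rightarrow> bool" where
  "small z (S, k, Qs) \<longleftrightarrow> length S + 1 \<le> z \<and> length Qs + 1 \<le> z"

lemma fn_ins:
  assumes "small z (S, k, Qs)" "r + 1 \<le> z" "\<forall>e\<in>set L. small z e"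
  shows "fn 9 [enc_ranking S, Num k, enc_list enc_ranking Qs, enc_list enc_entry L,
      enc_list Num (replicate r 0)] (enc_list enc_entry (ins r (S, k, Qs) L))
      ((length L + 1) * (2 * (z * (z * 30 + 20)) + z * 30 + 60))"
  using assms(3)
proof (induction L)
  case Nil
  show ?case
    by (rule fn_intro, simp, simp add: kemeny_prog_def, (rule ev_intros | simp)+)
next
  case (Cons e L)
  obtain S' k' Qs' where e: "e = (S', k', Qs')" by (cases e)
  have S: "length S + 1 \<le> z" and S': "length S' + 1 \<le> z" using assms(1) Cons.prems e by auto
  define B where "B = z * (z * 30 + 20)"
  note sub1 = fn_conv[OF fn_subset[OF S'] refl, OF mult_le_mono1[OF S], folded B_def]
  note sub2 = fn_conv[OF fn_subset[OF S] refl, OF mult_le_mono1[OF S'], folded B_def]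
  note ta = fn_conv[OF fn_take_append refl, OF mult_le_mono1[OF assms(2)]]
  have IH: "fn 9 [enc_ranking S, Num k, enc_list enc_ranking Qs, enc_list enc_entry L,
      enc_list Num (replicate r 0)] (enc_list enc_entry (ins r (S, k, Qs) L))
      ((length L + 1) * (2 * B + z * 30 + 60))"
    unfolding B_def using Cons.prems by (intro Cons.IH) auto
  have "fn 9 [enc_ranking S, Num k, enc_list enc_ranking Qs, enc_list enc_entry (e # L),
      enc_list Num (replicate r 0)] (enc_list enc_entry (ins r (S, k, Qs) (e # L)))
      ((length (e # L) + 1) * (2 * B + z * 30 + 60))"
  proof (cases "set S = set S'")
    case True
    consider "k < k'" | "k' < k" | "k = k'" by linarith
    then show ?thesis
      by cases (rule fn_intro, simp, simp add: kemeny_prog_def e,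
       (rule ev_intros IH sub1 sub2 ta | simp add: True e)+)+
  next
    case False
    then have F: "\<not> (set S \<subseteq> set S' \<and> set S' \<subseteq> set S)" by auto
    show ?thesis
      by (rule fn_intro, simp, simp add: kemeny_prog_def e,
       (rule ev_intros IH sub1 sub2 ta | simp add: False e F)+)
  qed
  then show ?case unfolding B_def .
qed

fun expand :: "nat \<Rightarrow> nat list \<Rightarrow> nat list list \<Rightarrow> nat list \<Rightarrow> entry \<Rightarrow> entry list \<Rightarrow> entry list" where
  "expand r cs vs [] e L = L"
| "expand r cs vs (c # ds) (S, k, Qs) L = expand r cs vs ds (S, k, Qs)
    (if c \<notin> set S \<and> admissible vs (set cs) c (set S)
     then ins r (c # S, k + top_cost vs c S, map (Cons c) Qs) L else L)"

primrec step :: "nat \<Rightarrow> nat list \<Rightarrow> nat list list \<Rightarrow> entry list \<Rightarrow> entry list \<Rightarrow> entry list" where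
  "step r cs vs [] acc = acc"
| "step r cs vs (e # L) acc = step r cs vs L (expand r cs vs cs e acc)"

primrec layers :: "nat \<Rightarrow> nat list \<Rightarrow> nat list list \<Rightarrow> nat \<Rightarrow> entry list \<Rightarrow> entry list" where
  "layers r cs vs 0 L = L"
| "layers r cs vs (Suc i) L = layers r cs vs i (step r cs vs L [])"

lemma length_ins_le: "length (ins r e L) \<le> length L + 1"
proof (induction L)
  case (Cons e' L)
  then show ?case by (cases e; cases e') simp
qed simp

lemma small_ins:
  assumes "small z e" "r + 1 \<le> z" "\<forall>e\<in>set L. small z e"
  shows "\<forall>e\<in>set (ins r e L). small z e"
  using assms(3)
proof (induction L)
  case (Cons e' L)
  then show ?case using assms(1,2) by (cases e; cases e') (auto simp del: take_append)
qed (use assms in simp)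

lemma length_expand_le: "length (expand r cs vs ds e L) \<le> length L + length ds"
proof (induction ds arbitrary: L)
  case (Cons c ds)
  obtain S k Qs where e: "e = (S, k, Qs)" by (cases e)
  show ?case
    using Cons[of L] Cons[of "ins r (c # S, k + top_cost vs c S, map (Cons c) Qs) L"]
      length_ins_le[of r "(c # S, k + top_cost vs c S, map (Cons c) Qs)" L]
    by (simp add: e)
qed simp

lemma small_expand:
  assumes "length (fst e) + 2 \<le> z" "small z e" "r + 1 \<le> z" "\<forall>e\<in>set L. small z e"
  shows "\<forall>e\<in>set (expand r cs vs ds e L). small z e"
  using assms(4)
proof (induction ds arbitrary: L)
  case (Cons c ds)
  obtain S k Qs where e: "e = (S, k, Qs)" by (cases e)
  have "\<forall>e\<in>set (ins r (c # S, k + top_cost vs c S, map (Cons c) Qs) L). small z e"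
    by (rule small_ins[OF _ assms(3) Cons.prems]) (use assms(1,2) e in simp)
  from Cons.IH[OF this] Cons.IH[OF Cons.prems] show ?case by (simp add: e)
qed simp

definition ins_time :: "nat \<Rightarrow> nat" where
  "ins_time z = 2 * (z * (z * 30 + 20)) + z * 30 + 60"

definition expand_time :: "nat \<Rightarrow> nat \<Rightarrow> nat" where
  "expand_time z M = z * 30 + z * (z * (50 * z + 50) + 30) + z * (z * (50 * z + 20) + 20)
     + z * 30 + (M + 1) * ins_time z + 100"

definition layer_bounds :: "nat \<Rightarrow> nat \<Rightarrow> nat list \<Rightarrow> nat list list \<Rightarrow> bool" where
  "layer_bounds z r cs vs \<longleftrightarrow> (\<forall>v\<in>set vs. length v + 1 \<le> z) \<and> length vs + 1 \<le> z \<and>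
     r + 1 \<le> z \<and> length cs + 1 \<le> z"

lemma fn_expand:
  assumes "layer_bounds z r cs vs" "length S + 2 \<le> z" "length Qs + 1 \<le> z"
    "\<forall>e\<in>set L. small z e" "length L + length ds \<le> M"
  shows "fn 10 [enc_ranking ds, enc_ranking S, Num k, enc_list enc_ranking Qs,
      enc_list enc_entry L, enc_ranking cs, enc_list enc_ranking vs, enc_list Num (replicate r 0)]
      (enc_list enc_entry (expand r cs vs ds (S, k, Qs) L)) ((length ds + 1) * expand_time z M)"
  using assms(4,5)
proof (induction ds arbitrary: L)
  case Nil
  show ?case
    by (rule fn_intro, simp, simp add: kemeny_prog_def, (rule ev_intros | simp add: expand_time_def)+)
next
  case (Cons c ds)
  have vs: "\<forall>v\<in>set vs. length v + 1 \<le> z" "length vs + 1 \<le> z" and r: "r + 1 \<le> z"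
    and cs: "length cs + 1 \<le> z" and S: "length S + 1 \<le> z"
    using assms(1,2) by (auto simp: layer_bounds_def)
  define A where "A = z * (z * (50 * z + 50) + 30)"
  define B where "B = z * (z * (50 * z + 20) + 20)"
  define I where "I = (M + 1) * ins_time z"
  define e where "e = (c # S, k + top_cost vs c S, map (Cons c) Qs)"
  have e: "small z e" using assms(2,3) by (simp add: e_def)
  note mem = fn_conv[OF fn_mem refl, OF mult_le_mono1[OF S]]
  note adm = fn_conv[OF fn_admissible[OF vs S] refl, OF mult_le_mono1[OF cs], folded A_def]
  note top = fn_conv[OF fn_top_cost[OF vs] refl, OF mult_le_mono1[OF S], folded B_def]
  note mpc = fn_conv[OF fn_map_Cons refl, OF mult_le_mono1[OF assms(3)]]
  have "length L + 1 \<le> M + 1" using Cons.prems(2) by simp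
  then have "(length L + 1) * ins_time z \<le> I" unfolding I_def by (rule mult_le_mono1)
  with fn_ins[OF e[unfolded e_def] r Cons.prems(1)]
  have ins: "fn 9 [Cell (Num c) (enc_ranking S), Num (k + top_cost vs c S),
      enc_list enc_ranking (map (Cons c) Qs), enc_list enc_entry L, enc_list Num (replicate r 0)]
      (enc_list enc_entry (ins r e L)) I"
    unfolding e_def ins_time_def[symmetric] by (auto intro: fn_conv)
  define E where "E = expand_time z M"
  have E: "E = z * 30 + A + B + z * 30 + I + 100"
    by (simp add: E_def expand_time_def A_def B_def I_def)
  show ?case
  proof (cases "c \<notin> set S \<and> admissible vs (set cs) c (set S)")
    case True
    have IH: "fn 10 [enc_ranking ds, enc_ranking S, Num k, enc_list enc_ranking Qs,
      enc_list enc_entry (ins r e L), enc_ranking cs, enc_list enc_ranking vs, enc_list Num (replicate r 0)]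
      (enc_list enc_entry (expand r cs vs ds (S, k, Qs) (ins r e L))) ((length ds + 1) * E)"
      unfolding E_def using small_ins[OF e r Cons.prems(1)] Cons.prems(2) length_ins_le[of r e L]
      by (intro Cons.IH) auto
    show ?thesis unfolding E_def[symmetric]
      by (rule fn_intro, simp, simp add: kemeny_prog_def,
        (rule ev_intros IH mem adm top mpc ins | simp add: True e_def[symmetric] E)+)
  next
    case False
    have IH: "fn 10 [enc_ranking ds, enc_ranking S, Num k, enc_list enc_ranking Qs,
      enc_list enc_entry L, enc_ranking cs, enc_list enc_ranking vs, enc_list Num (replicate r 0)]
      (enc_list enc_entry (expand r cs vs ds (S, k, Qs) L)) ((length ds + 1) * E)"
      unfolding E_def using Cons.prems by (intro Cons.IH) auto
    from False consider "c \<in> set S" | "c \<notin> set S" "\<not> admissible vs (set cs) c (set S)" by blast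
    then show ?thesis
    proof cases
      case 1
      show ?thesis unfolding E_def[symmetric]
        by (rule fn_intro, simp, simp add: kemeny_prog_def,
          (rule ev_intros IH mem adm | simp add: 1 E)+)
    next
      case 2
      show ?thesis unfolding E_def[symmetric]
        by (rule fn_intro, simp, simp add: kemeny_prog_def,
          (rule ev_intros IH mem adm | simp add: 2 E)+)
    qed
  qed
qed

definition fits :: "nat \<Rightarrow> entry \<Rightarrow> bool" where
  "fits z e \<longleftrightarrow> length (fst e) + 2 \<le> z \<and> length (snd (snd e)) + 1 \<le> z"

lemma fits_imp_small: "fits z e \<Longrightarrow> small z e"
  by (cases e) (simp add: fits_def)

lemma fn_step:
  assumes "layer_bounds z r cs vs" "\<forall>e\<in>set L. fits z e"
    "\<forall>e\<in>set acc. small z e" "length acc + length L * length cs \<le> M"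
  shows "fn 11 [enc_list enc_entry L, enc_list enc_entry acc, enc_ranking cs,
      enc_list enc_ranking vs, enc_list Num (replicate r 0)]
      (enc_list enc_entry (step r cs vs L acc)) ((length L + 1) * (z * expand_time z M + 40))"
  using assms(2-)
proof (induction L arbitrary: acc)
  case Nil
  show ?case
    by (rule fn_intro, simp, simp add: kemeny_prog_def, (rule ev_intros | simp)+)
next
  case (Cons e L)
  obtain S k Qs where e: "e = (S, k, Qs)" by (cases e)
  have fits: "fits z e" using Cons.prems(1) by simp
  have cs: "length cs + 1 \<le> z" and r: "r + 1 \<le> z" using assms(1) by (auto simp: layer_bounds_def)
  define B where "B = z * expand_time z M"
  have "length S + 2 \<le> z" "length Qs + 1 \<le> z" using fits e by (auto simp: fits_def)
  from fn_expand[OF assms(1) this Cons.prems(2), of cs M]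
  have ex: "fn 10 [enc_ranking cs, enc_ranking S, Num k, enc_list enc_ranking Qs,
      enc_list enc_entry acc, enc_ranking cs, enc_list enc_ranking vs, enc_list Num (replicate r 0)]
      (enc_list enc_entry (expand r cs vs cs e acc)) B"
    using Cons.prems(3) mult_le_mono1[OF cs, of "expand_time z M"]
    unfolding B_def e by (auto intro: fn_conv)
  have IH: "fn 11 [enc_list enc_entry L, enc_list enc_entry (expand r cs vs cs e acc), enc_ranking cs,
      enc_list enc_ranking vs, enc_list Num (replicate r 0)]
      (enc_list enc_entry (step r cs vs L (expand r cs vs cs e acc))) ((length L + 1) * (B + 40))"
    unfolding B_def
  proof (rule Cons.IH)
    show "\<forall>e\<in>set (expand r cs vs cs e acc). small z e"
      using fits Cons.prems(2) r by (intro small_expand) (auto simp: fits_def fits_imp_small)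
    show "length (expand r cs vs cs e acc) + length L * length cs \<le> M"
      using length_expand_le[of r cs vs cs e acc] Cons.prems(3) by simp
  qed (use Cons.prems in auto)
  have "fn 11 [enc_list enc_entry (e # L), enc_list enc_entry acc, enc_ranking cs,
      enc_list enc_ranking vs, enc_list Num (replicate r 0)]
      (enc_list enc_entry (step r cs vs (e # L) acc)) ((length (e # L) + 1) * (B + 40))"
    by (rule fn_intro, simp, simp add: kemeny_prog_def e,
        (rule ev_intros IH[unfolded e] ex[unfolded e] | simp add: e)+)
  then show ?case unfolding B_def .
qed

definition step_time :: "nat \<Rightarrow> nat \<Rightarrow> nat" where
  "step_time z N = (N + 1) * (z * expand_time z (N * z) + 40)"

lemma fn_layers:
  assumes "layer_bounds z r cs vs"
    "\<And>i. i < length ds \<Longrightarrow> length (layers r cs vs i L) \<le> N"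
    "\<And>i e. i < length ds \<Longrightarrow> e \<in> set (layers r cs vs i L) \<Longrightarrow> fits z e"
  shows "fn 12 [enc_ranking ds, enc_list enc_entry L, enc_ranking cs,
      enc_list enc_ranking vs, enc_list Num (replicate r 0)]
      (enc_list enc_entry (layers r cs vs (length ds) L))
      ((length ds + 1) * (step_time z N + 40))"
  using assms(2-)
proof (induction ds arbitrary: L)
  case Nil
  show ?case
    by (rule fn_intro, simp, simp add: kemeny_prog_def, (rule ev_intros | simp)+)
next
  case (Cons d ds)
  have cs: "length cs \<le> z" using assms(1) by (auto simp: layer_bounds_def)
  have L: "length L \<le> N" "\<forall>e\<in>set L. fits z e" using Cons.prems[of 0] by auto
  have "length [] + length L * length cs \<le> N * z" using L(1) cs by (simp add: mult_le_mono)
  note st' = fn_step[OF assms(1) L(2) _ this]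
  have st: "fn 11 [enc_list enc_entry L, Num 0, enc_ranking cs,
      enc_list enc_ranking vs, enc_list Num (replicate r 0)]
      (enc_list enc_entry (step r cs vs L [])) (step_time z N)"
    by (rule fn_conv[OF st'[simplified] refl, unfolded step_time_def])
       (use L(1) in \<open>simp_all add: step_time_def\<close>)
  have IH: "fn 12 [enc_ranking ds, enc_list enc_entry (step r cs vs L []), enc_ranking cs,
      enc_list enc_ranking vs, enc_list Num (replicate r 0)]
      (enc_list enc_entry (layers r cs vs (length ds) (step r cs vs L []))) ((length ds + 1) * (step_time z N + 40))"
    using Cons.prems(1)[of "Suc _"] Cons.prems(2)[of "Suc _"]
    by (intro Cons.IH) auto
  have "fn 12 [enc_ranking (d # ds), enc_list enc_entry L, enc_ranking cs,
      enc_list enc_ranking vs, enc_list Num (replicate r 0)]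
      (enc_list enc_entry (layers r cs vs (length (d # ds)) L)) ((length (d # ds) + 1) * (step_time z N + 40))"
    by (rule fn_intro, simp, simp add: kemeny_prog_def, (rule ev_intros IH st | simp)+)
  then show ?case .
qed

definition initial_layer :: "nat \<Rightarrow> entry list" where
  "initial_layer r = [([], 0, take r [[]])]"

lemma runs_kemeny_prog:
  assumes "layer_bounds z r cs vs"
    "\<And>i. i < length cs \<Longrightarrow> length (layers r cs vs i (initial_layer r)) \<le> N"
    "\<And>i e. i < length cs \<Longrightarrow> e \<in> set (layers r cs vs i (initial_layer r)) \<Longrightarrow> fits z e"
    "layers r cs vs (length cs) (initial_layer r) = (S, k, Qs) # L"
  shows "\<exists>t \<le> z * (step_time z N + 40) + z * 30 + 60.
    runs kemeny_prog (Cell (enc_ranking cs) (Cell (enc_list enc_ranking vs)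
      (enc_list Num (replicate r 0)))) (enc_list enc_ranking Qs) t"
proof -
  define B where "B = step_time z N + 40"
  have cs: "length cs + 1 \<le> z" and r: "r + 1 \<le> z" using assms(1) by (auto simp: layer_bounds_def)
  have "fn 12 [enc_ranking cs, enc_list enc_entry (initial_layer r), enc_ranking cs,
      enc_list enc_ranking vs, enc_list Num (replicate r 0)]
      (enc_list enc_entry ((S, k, Qs) # L)) (z * B)"
    unfolding assms(4)[symmetric]
    by (rule fn_conv[OF fn_layers[OF assms(1), of cs _ N] refl])
       (use assms(2,3) cs in \<open>auto simp: B_def simp del: mult_Suc\<close>)
  then have la: "fn 12 [enc_ranking cs,
      Cell (Cell (Num 0) (Cell (Num 0) (enc_list enc_ranking (take r [[]])))) (Num 0), enc_ranking cs,
      enc_list enc_ranking vs, enc_list Num (replicate r 0)]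
      (Cell (Cell (enc_ranking S) (Cell (Num k) (enc_list enc_ranking Qs))) (enc_list enc_entry L)) (z * B)"
    by (simp add: initial_layer_def)
  have ta: "fn 7 [enc_list Num (replicate r 0), Cell (Num 0) (Num 0), Num 0]
    (enc_list enc_ranking (take r [[]])) (z * 30)"
    using fn_conv[OF fn_take_append[of r enc_ranking "[[]]" "[]"] refl, OF mult_le_mono1[OF r]]
    by simp
  have "fn 0 [Cell (enc_ranking cs) (Cell (enc_list enc_ranking vs) (enc_list Num (replicate r 0)))]
     (enc_list enc_ranking Qs) (z * B + z * 30 + 50)"
    by (rule fn_intro, simp, simp add: kemeny_prog_def, (rule ev_intros la ta | simp)+)
  then have main: "ev [Cell (enc_ranking cs) (Cell (enc_list enc_ranking vs) (enc_list Num (replicate r 0)))]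
     (ECall 0 [EVar 0]) (enc_list enc_ranking Qs) (1 + 0 + (z * B + z * 30 + 50) + 1)"
    by (rule ev_Call[OF evs_Cons[OF ev_Var(1) evs_Nil]])
  have "1 + 0 + (z * B + z * 30 + 50) + 1 \<le> z * B + z * 30 + 60" by simp
  with main show ?thesis unfolding ev_def runs_def B_def[symmetric] by (meson le_trans)
qed

section \<open>Correctness of the dynamic program\<close>

primrec list_cost :: "'c list list \<Rightarrow> 'c list \<Rightarrow> nat" where
  "list_cost vs [] = 0"
| "list_cost vs (c # Q) = top_cost vs c Q + list_cost vs Q"

primrec feasible :: "'c list list \<Rightarrow> 'c set \<Rightarrow> 'c list \<Rightarrow> bool" where
  "feasible vs C [] \<longleftrightarrow> True"
| "feasible vs C (c # Q) \<longleftrightarrow>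
     c \<in> C \<and> c \<notin> set Q \<and> admissible vs C c (set Q) \<and> feasible vs C Q"

lemma feasible_distinct: "feasible vs C Q \<Longrightarrow> distinct Q \<and> set Q \<subseteq> C"
  by (induction Q) auto

lemma top_cost_cong:
  assumes "distinct S" "distinct Q" "set S = set Q"
  shows "top_cost vs c S = top_cost vs c Q"
  using assms by (simp add: top_cost_def sum_list_distinct_conv_sum_set)

definition best :: "('q \<Rightarrow> nat) \<Rightarrow> nat \<Rightarrow> 'q set \<Rightarrow> nat \<Rightarrow> 'q list \<Rightarrow> bool" where
  "best f r B k Qs \<longleftrightarrow> finite B \<and> (\<forall>Q\<in>B. k \<le> f Q) \<and> (\<exists>Q\<in>B. f Q = k) \<and>
     distinct Qs \<and> set Qs \<subseteq> {Q \<in> B. f Q = k} \<and> length Qs = min r (card {Q \<in> B. f Q = k})"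

lemma best_Un_less:
  assumes "best f r B k Qs" "best f r B' k' Qs'" "k < k'"
  shows "best f r (B \<union> B') k Qs"
proof -
  have "{Q \<in> B \<union> B'. f Q = k} = {Q \<in> B. f Q = k}"
    using assms by (fastforce simp: best_def)
  then show ?thesis using assms unfolding best_def by fastforce
qed

lemma best_Un_eq:
  assumes "best f r B k Qs" "best f r B' k Qs'" "B \<inter> B' = {}"
  shows "best f r (B \<union> B') k (take r (Qs @ Qs'))"
proof -
  have eq: "{Q \<in> B \<union> B'. f Q = k} = {Q \<in> B. f Q = k} \<union> {Q \<in> B'. f Q = k}" by auto
  have card: "card {Q \<in> B \<union> B'. f Q = k} = card {Q \<in> B. f Q = k} + card {Q \<in> B'. f Q = k}"
    unfolding eq using assms by (intro card_Un_disjoint) (auto simp: best_def)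
  have "distinct (Qs @ Qs')" using assms by (auto simp: best_def)
  then have "distinct (take r (Qs @ Qs'))" by (rule distinct_take)
  moreover have "set (take r (Qs @ Qs')) \<subseteq> {Q \<in> B \<union> B'. f Q = k}"
    using set_take_subset[of r "Qs @ Qs'"] assms by (fastforce simp: best_def)
  moreover have "length (take r (Qs @ Qs')) = min r (card {Q \<in> B \<union> B'. f Q = k})"
    unfolding card using assms by (auto simp: best_def)
  ultimately show ?thesis using assms unfolding best_def by blast
qed

lemma best_Cons:
  assumes "best (list_cost vs) r B k Qs" "\<And>Q. Q \<in> B \<Longrightarrow> distinct Q \<and> set Q = set S" "distinct S"
  shows "best (list_cost vs) r (Cons c ` B) (k + top_cost vs c S) (map (Cons c) Qs)"
proof -
  have cost: "list_cost vs (c # Q) = list_cost vs Q + top_cost vs c S" if "Q \<in> B" for Q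
    using assms(2)[OF that] assms(3) by (simp add: top_cost_cong[of Q S])
  have eq: "{Q \<in> Cons c ` B. list_cost vs Q = k + top_cost vs c S} =
      Cons c ` {Q \<in> B. list_cost vs Q = k}"
    using cost by (auto simp del: list_cost.simps)
  have card: "card (Cons c ` {Q \<in> B. list_cost vs Q = k}) = card {Q \<in> B. list_cost vs Q = k}"
    by (rule card_image) simp
  have "\<forall>Q\<in>Cons c ` B. k + top_cost vs c S \<le> list_cost vs Q"
    using assms(1) cost by (auto simp: best_def simp del: list_cost.simps)
  moreover have "\<exists>Q\<in>Cons c ` B. list_cost vs Q = k + top_cost vs c S"
    using assms(1) cost by (auto simp: best_def simp del: list_cost.simps)
  ultimately show ?thesis
    using assms(1) unfolding best_def eq card by (auto simp: distinct_map)
qed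

definition table :: "nat list list \<Rightarrow> nat \<Rightarrow> nat list set \<Rightarrow> entry list \<Rightarrow> bool" where
  "table vs r A L \<longleftrightarrow> distinct (map (set \<circ> fst) L) \<and> (set \<circ> fst) ` set L = set ` A \<and>
     (\<forall>(S, k, Qs)\<in>set L. distinct S \<and> best (list_cost vs) r {Q \<in> A. set Q = set S} k Qs)"

lemma table_Nil: "table vs r {} []"
  by (simp add: table_def)

lemma set_fst_ins: "(set \<circ> fst) ` set (ins r e L) = insert (set (fst e)) ((set \<circ> fst) ` set L)"
proof (induction L)
  case (Cons e' L)
  then show ?case by (cases e; cases e') auto
qed simp

lemma distinct_ins:
  "distinct (map (set \<circ> fst) L) \<Longrightarrow> distinct (map (set \<circ> fst) (ins r e L))"
proof (induction L)
  case (Cons e' L)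
  obtain S k Qs where e: "e = (S, k, Qs)" by (cases e)
  obtain S' k' Qs' where e': "e' = (S', k', Qs')" by (cases e')
  have "set S' \<notin> (set \<circ> fst) ` set (ins r e L)" if "set S \<noteq> set S'"
    unfolding set_fst_ins using that Cons.prems by (auto simp: e e')
  then show ?case using Cons by (auto simp: e e')
qed simp

lemma mem_ins_cases:
  assumes "(T, l, Rs) \<in> set (ins r (S, k, Qs) L)" "distinct (map (set \<circ> fst) L)"
  obtains "(T, l, Rs) \<in> set L" "set T \<noteq> set S"
  | "T = S" "l = k" "Rs = Qs" "set S \<notin> (set \<circ> fst) ` set L"
  | S' k' Qs' where "(S', k', Qs') \<in> set L" "set S' = set S"
      "k < k' \<and> (T, l, Rs) = (S, k, Qs) \<or> k' < k \<and> (T, l, Rs) = (S', k', Qs') \<or>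
       k = k' \<and> (T, l, Rs) = (S, k, take r (Qs @ Qs'))"
  using assms
proof (induction L arbitrary: thesis)
  case Nil
  then show ?case by simp
next
  case (Cons e' L)
  obtain S' k' Qs' where e': "e' = (S', k', Qs')" by (cases e')
  show ?case
  proof (cases "set S = set S'")
    case True
    show ?thesis
    proof (cases "(T, l, Rs) \<in> set L")
      case in_L: True
      then have "set T \<noteq> set S'" using Cons.prems(5) by (force simp: e')
      then show ?thesis using Cons.prems(1) in_L True by auto
    next
      case False
      then show ?thesis using Cons.prems(3)[of S' k' Qs'] Cons.prems(4) True
        by (auto simp: e' simp del: take_append split: if_splits)
    qed
  next
    case False
    then consider "(T, l, Rs) = e'" | "(T, l, Rs) \<in> set (ins r (S, k, Qs) L)"
      using Cons.prems(4) by (auto simp: e')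
    then show ?thesis
    proof cases
      case 1
      then show ?thesis using Cons.prems(1) False by (auto simp: e')
    next
      case 2
      show ?thesis
      proof (rule Cons.IH[OF _ _ _ 2])
        show "(T, l, Rs) \<in> set L \<Longrightarrow> set T \<noteq> set S \<Longrightarrow> thesis"
          using Cons.prems(1) by auto
        show "T = S \<Longrightarrow> l = k \<Longrightarrow> Rs = Qs \<Longrightarrow> set S \<notin> (set \<circ> fst) ` set L \<Longrightarrow> thesis"
          using Cons.prems(2) False by (auto simp: e')
        show thesis if "(S', k', Qs') \<in> set L" "set S' = set S"
          "k < k' \<and> (T, l, Rs) = (S, k, Qs) \<or> k' < k \<and> (T, l, Rs) = (S', k', Qs') \<or>
            k = k' \<and> (T, l, Rs) = (S, k, take r (Qs @ Qs'))" for S' k' Qs'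
          by (rule Cons.prems(3)[OF _ that(2,3)]) (use that(1) in simp)
        show "distinct (map (set \<circ> fst) L)" using Cons.prems(5) by (simp add: o_def)
      qed
    qed
  qed
qed

lemma table_ins:
  assumes "table vs r A L" "distinct S" "best (list_cost vs) r B k Qs"
    "\<And>Q. Q \<in> B \<Longrightarrow> set Q = set S" "A \<inter> B = {}"
  shows "table vs r (A \<union> B) (ins r (S, k, Qs) L)"
proof -
  have dist: "distinct (map (set \<circ> fst) L)" and img: "(set \<circ> fst) ` set L = set ` A"
    and ent: "\<And>T l Rs. (T, l, Rs) \<in> set L \<Longrightarrow>
      distinct T \<and> best (list_cost vs) r {Q \<in> A. set Q = set T} l Rs"
    using assms(1) by (auto simp: table_def)
  have "B \<noteq> {}" using assms(3) by (auto simp: best_def)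
  then have "set ` B = {set S}" using assms(4) by auto
  then have img': "(set \<circ> fst) ` set (ins r (S, k, Qs) L) = set ` (A \<union> B)"
    unfolding set_fst_ins img by (simp add: image_Un)
  have "distinct T \<and> best (list_cost vs) r {Q \<in> A \<union> B. set Q = set T} l Rs"
    if "(T, l, Rs) \<in> set (ins r (S, k, Qs) L)" for T l Rs
    using that dist
  proof (cases rule: mem_ins_cases)
    case 1
    then have "{Q \<in> A \<union> B. set Q = set T} = {Q \<in> A. set Q = set T}" using assms(4) by auto
    then show ?thesis using ent[OF 1(1)] by simp
  next
    case 2
    have "set S \<notin> set ` A" using 2(4) unfolding img .
    then have "{Q \<in> A \<union> B. set Q = set T} = B" using assms(4) 2(1) by auto
    then show ?thesis using 2 assms(2,3) by simp
  next
    case (3 S' k' Qs')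
    have "set T = set S" using 3 by auto
    then have eq: "{Q \<in> A \<union> B. set Q = set T} = B \<union> {Q \<in> A. set Q = set S'}"
      using assms(4) 3(2) by auto
    have old: "distinct S'" "best (list_cost vs) r {Q \<in> A. set Q = set S'} k' Qs'"
      using ent[OF 3(1)] by auto
    have disj: "B \<inter> {Q \<in> A. set Q = set S'} = {}" using assms(5) by auto
    from 3(3) show ?thesis
    proof (elim disjE conjE)
      assume "k < k'" "(T, l, Rs) = (S, k, Qs)"
      then show ?thesis using best_Un_less[OF assms(3) old(2)] assms(2) eq by simp
    next
      assume "k' < k" "(T, l, Rs) = (S', k', Qs')"
      then show ?thesis using best_Un_less[OF old(2) assms(3)] old(1) eq by (simp add: Un_commute)
    next
      assume "k = k'" "(T, l, Rs) = (S, k, take r (Qs @ Qs'))"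
      then show ?thesis using best_Un_eq[OF assms(3) _ disj] old(2) assms(2) eq by simp
    qed
  qed
  then show ?thesis unfolding table_def using img' distinct_ins[OF dist] by auto
qed

definition extensions :: "nat list list \<Rightarrow> nat set \<Rightarrow> nat set \<Rightarrow> nat set \<Rightarrow> nat list set" where
  "extensions vs C D X = {c # Q | c Q. c \<in> D \<and> feasible vs C (c # Q) \<and> set Q = X}"

lemma table_expand:
  assumes "table vs r A L" "distinct S" "set ds \<subseteq> set cs" "distinct ds"
    "best (list_cost vs) r {Q. feasible vs (set cs) Q \<and> set Q = set S} k Qs"
    "A \<inter> extensions vs (set cs) (set ds) (set S) = {}"
  shows "table vs r (A \<union> extensions vs (set cs) (set ds) (set S)) (expand r cs vs ds (S, k, Qs) L)"
  using assms(1,3,4,6)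
proof (induction ds arbitrary: A L)
  case Nil
  then show ?case by (simp add: extensions_def)
next
  case (Cons c ds)
  let ?F = "{Q. feasible vs (set cs) Q \<and> set Q = set S}"
  show ?case
  proof (cases "c \<notin> set S \<and> admissible vs (set cs) c (set S)")
    case True
    have B: "extensions vs (set cs) {c} (set S) = Cons c ` ?F"
      using True Cons.prems(2) by (auto simp: extensions_def)
    have ext: "extensions vs (set cs) (set (c # ds)) (set S) =
        Cons c ` ?F \<union> extensions vs (set cs) (set ds) (set S)"
      unfolding B[symmetric] by (auto simp: extensions_def)
    have disj: "Cons c ` ?F \<inter> extensions vs (set cs) (set ds) (set S) = {}"
      using Cons.prems(3) by (auto simp: extensions_def)
    have "table vs r (A \<union> Cons c ` ?F) (ins r (c # S, k + top_cost vs c S, map (Cons c) Qs) L)"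
    proof (rule table_ins[OF Cons.prems(1)])
      show "distinct (c # S)" using True assms(2) by simp
      show "best (list_cost vs) r (Cons c ` ?F) (k + top_cost vs c S) (map (Cons c) Qs)"
        using assms(2,5) feasible_distinct by (intro best_Cons) auto
      show "A \<inter> Cons c ` ?F = {}" using Cons.prems(4) ext by auto
    qed auto
    from Cons.IH[OF this] Cons.prems disj
    have "table vs r (A \<union> Cons c ` ?F \<union> extensions vs (set cs) (set ds) (set S))
      (expand r cs vs ds (S, k, Qs) (ins r (c # S, k + top_cost vs c S, map (Cons c) Qs) L))"
      unfolding ext by auto
    then show ?thesis unfolding ext using True by (simp add: Un_assoc)
  next
    case False
    then have ext: "extensions vs (set cs) (set (c # ds)) (set S) =
        extensions vs (set cs) (set ds) (set S)"
      by (auto simp: extensions_def)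
    from False Cons.IH[OF Cons.prems(1)] Cons.prems show ?thesis unfolding ext by auto
  qed
qed

lemma table_step:
  assumes "distinct cs" "table vs r A acc" "distinct (map (set \<circ> fst) L)"
    "\<And>S k Qs. (S, k, Qs) \<in> set L \<Longrightarrow> distinct S \<and>
       best (list_cost vs) r {Q. feasible vs (set cs) Q \<and> set Q = set S} k Qs"
    "\<And>e. e \<in> set L \<Longrightarrow> A \<inter> extensions vs (set cs) (set cs) (set (fst e)) = {}"
  shows "table vs r (A \<union> (\<Union>e\<in>set L. extensions vs (set cs) (set cs) (set (fst e))))
    (step r cs vs L acc)"
  using assms(2-)
proof (induction L arbitrary: A acc)
  case Nil
  then show ?case by simp
next
  case (Cons e L)
  obtain S k Qs where e: "e = (S, k, Qs)" by (cases e)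
  have S: "distinct S" "best (list_cost vs) r {Q. feasible vs (set cs) Q \<and> set Q = set S} k Qs"
    using Cons.prems(3)[of S k Qs] by (auto simp: e)
  let ?E = "\<lambda>e. extensions vs (set cs) (set cs) (set (fst e))"
  have "table vs r (A \<union> ?E e) (expand r cs vs cs e acc)"
    using table_expand[OF Cons.prems(1) S(1) order_refl assms(1) S(2)] Cons.prems(4)[of e]
    by (simp add: e)
  note tab = this
  have disj: "(A \<union> ?E e) \<inter> ?E e' = {}" if "e' \<in> set L" for e'
  proof -
    have "set (fst e') \<noteq> set (fst e)" using Cons.prems(2) that by (auto simp: image_iff)
    then have "?E e \<inter> ?E e' = {}" by (auto simp: extensions_def)
    then show ?thesis using Cons.prems(4)[of e'] that by auto
  qed
  have "table vs r (A \<union> ?E e \<union> (\<Union>e\<in>set L. ?E e)) (step r cs vs L (expand r cs vs cs e acc))"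
  proof (rule Cons.IH[OF tab _ _ disj])
    show "distinct (map (set \<circ> fst) L)" using Cons.prems(2) by (simp add: o_def)
    show "distinct S \<and> best (list_cost vs) r {Q. feasible vs (set cs) Q \<and> set Q = set S} k Qs"
      if "(S, k, Qs) \<in> set L" for S k Qs
      using that by (intro Cons.prems(3)) simp
  qed
  then show ?case by (simp add: Un_assoc)
qed

definition feasible_of_length :: "nat list list \<Rightarrow> nat set \<Rightarrow> nat \<Rightarrow> nat list set" where
  "feasible_of_length vs C i = {Q. feasible vs C Q \<and> length Q = i}"

lemma feasible_fiber:
  assumes "distinct S" "length S = i"
  shows "{Q \<in> feasible_of_length vs C i. set Q = set S} = {Q. feasible vs C Q \<and> set Q = set S}"
proof -
  have "length Q = i" if "feasible vs C Q" "set Q = set S" for Q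
    using that assms feasible_distinct[OF that(1)] distinct_card by metis
  then show ?thesis by (auto simp: feasible_of_length_def)
qed

lemma table_entry_length:
  assumes "table vs r (feasible_of_length vs C i) L" "(S, k, Qs) \<in> set L"
  shows "length S = i"
proof -
  have img: "(set \<circ> fst) ` set L = set ` feasible_of_length vs C i"
    and ent: "\<forall>(S, k, Qs)\<in>set L. distinct S \<and>
      best (list_cost vs) r {Q \<in> feasible_of_length vs C i. set Q = set S} k Qs"
    using assms(1) by (simp_all add: table_def)
  have "set S \<in> set ` feasible_of_length vs C i"
    unfolding img[symmetric] using assms(2) by (rule rev_image_eqI) simp
  then obtain Q where "set S = set Q" "feasible vs C Q" "length Q = i"
    by (auto simp: feasible_of_length_def)
  moreover have "distinct S" using ent assms(2) by auto
  ultimately show ?thesis using feasible_distinct[of vs C Q] distinct_card by metis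
qed

lemma table_next:
  assumes "distinct cs" "table vs r (feasible_of_length vs (set cs) i) L"
  shows "table vs r (feasible_of_length vs (set cs) (Suc i)) (step r cs vs L [])"
proof -
  let ?E = "\<lambda>e. extensions vs (set cs) (set cs) (set (fst e))"
  have "table vs r ({} \<union> (\<Union>e\<in>set L. ?E e)) (step r cs vs L [])"
  proof (rule table_step[OF assms(1) table_Nil])
    show "distinct (map (set \<circ> fst) L)" using assms(2) by (simp add: table_def)
    fix S k Qs assume mem: "(S, k, Qs) \<in> set L"
    then have "distinct S" "best (list_cost vs) r {Q \<in> feasible_of_length vs (set cs) i. set Q = set S} k Qs"
      using assms(2) by (auto simp: table_def)
    then show "distinct S \<and> best (list_cost vs) r {Q. feasible vs (set cs) Q \<and> set Q = set S} k Qs"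
      using feasible_fiber[OF _ table_entry_length[OF assms(2) mem]] by simp
  qed simp
  moreover have "(\<Union>e\<in>set L. ?E e) = feasible_of_length vs (set cs) (Suc i)"
  proof (intro set_eqI iffI)
    fix Q assume "Q \<in> (\<Union>e\<in>set L. ?E e)"
    then obtain S k Qs c R where R: "(S, k, Qs) \<in> set L" "Q = c # R" "feasible vs (set cs) Q" "set R = set S"
      by (auto simp: extensions_def)
    have "length S = i" "distinct S"
      using table_entry_length[OF assms(2) R(1)] assms(2) R(1) by (auto simp: table_def)
    then have "length R = i" using R feasible_distinct[of vs "set cs" R] distinct_card
      by (metis feasible.simps(2))
    then show "Q \<in> feasible_of_length vs (set cs) (Suc i)" using R by (simp add: feasible_of_length_def)
  next
    fix Q assume "Q \<in> feasible_of_length vs (set cs) (Suc i)"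
    then obtain c R where R: "Q = c # R" "feasible vs (set cs) Q" "length R = i"
      by (auto simp: feasible_of_length_def length_Suc_conv)
    then have "R \<in> feasible_of_length vs (set cs) i" by (simp add: feasible_of_length_def)
    then have "set R \<in> (set \<circ> fst) ` set L" using assms(2) by (auto simp: table_def)
    then obtain e where "e \<in> set L" "set R = set (fst e)" by auto
    then show "Q \<in> (\<Union>e\<in>set L. ?E e)" using R by (auto simp: extensions_def)
  qed
  ultimately show ?thesis by simp
qed

lemma table_initial: "table vs r (feasible_of_length vs C 0) (initial_layer r)"
proof -
  have "feasible_of_length vs C 0 = {[]}" by (auto simp: feasible_of_length_def)
  moreover have "{Q. Q = ([] :: nat list) \<and> list_cost vs Q = 0} = {[]}" by auto
  ultimately show ?thesis
    by (cases r) (auto simp: table_def initial_layer_def best_def)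
qed

lemma layers_Suc: "layers r cs vs (Suc i) L = step r cs vs (layers r cs vs i L) []"
  by (induction i arbitrary: L) auto

lemma table_layers:
  assumes "distinct cs"
  shows "table vs r (feasible_of_length vs (set cs) i) (layers r cs vs i (initial_layer r))"
proof (induction i)
  case 0
  show ?case using table_initial by simp
next
  case (Suc i)
  then show ?case unfolding layers_Suc by (rule table_next[OF assms])
qed

section \<open>Kemeny rankings\<close>

lemma above_order_of_list_Cons:
  assumes "distinct (c # Q)"
  shows "above (order_of_list (c # Q)) a b \<longleftrightarrow> a = c \<and> b \<in> set Q \<or> above (order_of_list Q) a b"
  using assms order_of_list_subset[of Q] by (auto simp: above_def order_of_list_Cons)

lemma above_order_of_list_mem:
  "above (order_of_list Q) a b \<Longrightarrow> a \<in> set Q \<and> b \<in> set Q \<and> a \<noteq> b"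
  using order_of_list_subset[of Q] by (auto simp: above_def)

lemma above_order_of_list_iff_bef:
  assumes "distinct v" "a \<in> set v" "b \<in> set v" "a \<noteq> b"
  shows "above (order_of_list v) a b \<longleftrightarrow> bef a b v"
  using assms
proof (induction v)
  case (Cons y v)
  show ?case
    using Cons above_order_of_list_mem[of v a b]
    by (auto simp: above_order_of_list_Cons[OF Cons.prems(1)])
qed simp

lemma order_of_list_inject:
  assumes "distinct xs" "distinct ys" "set xs = set ys" "order_of_list xs = order_of_list ys"
  shows "xs = ys"
proof -
  have "\<forall>a b. above (order_of_list xs) a b = above (order_of_list ys) a b" using assms by simp
  with assms(1-3) show ?thesis
  proof (induction xs arbitrary: ys)
    case (Cons x xs)
    then obtain y zs where ys: "ys = y # zs" by (cases ys) auto
    have ab: "(a = x \<and> b \<in> set xs \<or> above (order_of_list xs) a b) \<longleftrightarrow>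
       (a = y \<and> b \<in> set zs \<or> above (order_of_list zs) a b)" for a b
      using Cons.prems(4) unfolding ys
      by (simp only: above_order_of_list_Cons[OF Cons.prems(1)]
          above_order_of_list_Cons[OF Cons.prems(2)[unfolded ys]])
    have "x = y"
    proof (rule ccontr)
      assume "x \<noteq> y"
      then have "y \<in> set xs" using Cons.prems(3) ys by auto
      with ab[of x y] \<open>x \<noteq> y\<close> have "above (order_of_list zs) x y" by auto
      then have "y \<in> set zs" using above_order_of_list_mem[of zs x y] by simp
      then show False using Cons.prems(2) ys by simp
    qed
    have "xs = zs"
    proof (rule Cons.IH)
      show "set xs = set zs" using Cons.prems(1-3) ys \<open>x = y\<close> by auto
      show "\<forall>a b. above (order_of_list xs) a b = above (order_of_list zs) a b"
      proof (intro allI)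
        fix a b
        show "above (order_of_list xs) a b = above (order_of_list zs) a b"
          using ab[of a b] above_order_of_list_mem[of xs a b] above_order_of_list_mem[of zs a b]
            Cons.prems(1,2) ys \<open>x = y\<close> by auto
      qed
    qed (use Cons.prems ys in auto)
    then show ?case using ys \<open>x = y\<close> by simp
  qed simp
qed

lemma list_cost_eq_sum_pairs:
  assumes "distinct Q"
  shows "list_cost vs Q = (\<Sum>(a, b)\<in>{(a, b). above (order_of_list Q) a b}. against vs a b)"
  using assms
proof (induction Q)
  case (Cons c Q)
  have eq: "{(a, b). above (order_of_list (c # Q)) a b} =
      {c} \<times> set Q \<union> {(a, b). above (order_of_list Q) a b}"
    using above_order_of_list_Cons[OF Cons.prems] by auto
  have fin: "finite {(a, b). above (order_of_list Q) a b}"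
    by (rule finite_subset[of _ "set Q \<times> set Q"]) (use above_order_of_list_mem in fastforce)+
  have disj: "({c} \<times> set Q) \<inter> {(a, b). above (order_of_list Q) a b} = {}"
    using Cons.prems above_order_of_list_mem[of Q] by auto
  have "(\<Sum>(a, b)\<in>{c} \<times> set Q. against vs a b) = top_cost vs c Q"
    using Cons.prems
    by (simp add: sum.cartesian_product[symmetric] top_cost_def sum_list_distinct_conv_sum_set)
  then show ?case
    unfolding eq using Cons fin disj by (simp add: sum.union_disjoint)
qed (simp add: above_def [abs_def])

lemma kt_dist_eq_sum_pairs:
  assumes "distinct Q" "set Q = C" "distinct v" "set v = C"
  shows "kt_dist C (order_of_list Q) (order_of_list v) =
    (\<Sum>(a, b)\<in>{(a, b). above (order_of_list Q) a b}. of_bool (bef b a v))"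
proof -
  have fin: "finite {(a, b). above (order_of_list Q) a b}"
    by (rule finite_subset[of _ "set Q \<times> set Q"]) (use above_order_of_list_mem in fastforce)+
  have "{(a, b). a \<in> C \<and> b \<in> C \<and> above (order_of_list Q) a b \<and> above (order_of_list v) b a} =
    {(a, b). above (order_of_list Q) a b} \<inter> {(a, b). bef b a v}"
    using above_order_of_list_iff_bef[of v] above_order_of_list_mem[of Q] assms by fast
  then show ?thesis
    unfolding kt_dist_def
    using sum.inter_restrict[OF fin, of "\<lambda>_. 1::nat" "{(a, b). bef b a v}"]
    by (simp add: of_bool_def case_prod_unfold)
qed

lemma kemeny_score_eq_list_cost:
  assumes "distinct Q" "set Q = C" "\<forall>v\<in>set vs. distinct v \<and> set v = C"
  shows "kemeny_score C (mset (map order_of_list vs)) (order_of_list Q) = list_cost vs Q"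
proof -
  have "(\<Sum>v\<leftarrow>vs. kt_dist C (order_of_list Q) (order_of_list v)) =
    (\<Sum>(a, b)\<in>{(a, b). above (order_of_list Q) a b}. against vs a b)"
    using assms(3)
  proof (induction vs)
    case Nil
    then show ?case by (simp add: against_def)
  next
    case (Cons v vs)
    have ag: "against (v # vs) a b = of_bool (bef b a v) + against vs a b" for a b
      by (simp add: against_def)
    show ?case
      using Cons by (simp add: ag kt_dist_eq_sum_pairs[OF assms(1,2)] sum.distrib case_prod_unfold)
  qed
  then show ?thesis
    unfolding kemeny_score_def list_cost_eq_sum_pairs[OF assms(1)]
    by (simp add: sum_mset_sum_list[symmetric] image_mset.compositionality o_def)
qed

lemma bef_trans: "bef a b v \<Longrightarrow> bef b c v \<Longrightarrow> bef a c v"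
  by (induction v) auto

lemma bef_total: "a \<in> set v \<Longrightarrow> \<not> bef b a v \<Longrightarrow> bef a b v"
  by (induction v) auto

lemma bef_refl: "a \<in> set v \<Longrightarrow> bef a a v"
  by (induction v) auto

lemma against_eq_0_iff: "against vs a b = 0 \<longleftrightarrow> (\<forall>v\<in>set vs. \<not> bef b a v)"
  by (simp add: against_def filter_empty_conv)

lemma length_filter_mono:
  "(\<And>x. x \<in> set xs \<Longrightarrow> P x \<Longrightarrow> R x) \<Longrightarrow> length (filter P xs) \<le> length (filter R xs)"
  by (induction xs) auto

lemma top_cost_append: "top_cost vs c (xs @ ys) = top_cost vs c xs + top_cost vs c ys"
  by (simp add: top_cost_def)

lemma top_cost_Cons: "top_cost vs c (x # xs) = against vs c x + top_cost vs c xs"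
  by (simp add: top_cost_def)

lemma list_cost_append:
  "list_cost vs (xs @ ys) = list_cost vs xs + list_cost vs ys + (\<Sum>x\<leftarrow>xs. top_cost vs x ys)"
  by (induction xs) (auto simp: top_cost_append)

lemma list_cost_swap_less:
  assumes "\<forall>v\<in>set vs. set v = C" "vs \<noteq> []" "a \<in> C" "against vs a b = 0"
  shows "list_cost vs (us @ a # xs @ b # zs) < list_cost vs (us @ b # xs @ a # zs)"
proof -
  have ab: "bef a b v" if "v \<in> set vs" for v
    using assms that by (intro bef_total) (auto simp: against_eq_0_iff)
  have ax: "against vs a x \<le> against vs b x" for x
    unfolding against_def by (rule length_filter_mono) (rule bef_trans[OF _ ab])
  have xb: "against vs x b \<le> against vs x a" for x
    unfolding against_def by (rule length_filter_mono) (rule bef_trans[OF ab])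
  have "against vs b a > 0"
    using assms(2) ab by (cases vs) (auto simp: against_def)
  moreover have "top_cost vs a xs \<le> top_cost vs b xs"
    unfolding top_cost_def by (rule sum_list_mono) (rule ax)
  moreover have "(\<Sum>x\<leftarrow>xs. against vs x b) \<le> (\<Sum>x\<leftarrow>xs. against vs x a)"
    by (rule sum_list_mono) (rule xb)
  moreover have "(\<Sum>x\<leftarrow>us. top_cost vs x (a # xs @ b # zs)) = (\<Sum>x\<leftarrow>us. top_cost vs x (b # xs @ a # zs))"
    by (simp add: top_cost_Cons top_cost_append algebra_simps)
  ultimately show ?thesis
    using assms(4)
    by (simp add: list_cost_append top_cost_Cons top_cost_append sum_list_addf)
qed

lemma feasibleI:
  assumes "distinct Q" "set Q \<subseteq> C" "\<And>ps c R. Q = ps @ c # R \<Longrightarrow> admissible vs C c (set R)"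
  shows "feasible vs C Q"
  using assms
proof (induction Q)
  case (Cons c Q)
  have "admissible vs C c (set Q)" using Cons.prems(3)[of "[]"] by simp
  moreover have "feasible vs C Q"
  proof (rule Cons.IH)
    show "admissible vs C d (set R)" if "Q = ps @ d # R" for ps d R
      using Cons.prems(3)[of "c # ps"] that by simp
  qed (use Cons.prems in auto)
  ultimately show ?case using Cons.prems by simp
qed simp

lemma optimal_list_feasible:
  assumes "\<forall>v\<in>set vs. set v = C" "vs \<noteq> []" "distinct Q" "set Q = C"
    "\<And>Q'. distinct Q' \<Longrightarrow> set Q' = C \<Longrightarrow> list_cost vs Q \<le> list_cost vs Q'"
  shows "feasible vs C Q"
proof (rule feasibleI)
  fix ps c R assume Q: "Q = ps @ c # R"
  show "admissible vs C c (set R)"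
    unfolding admissible_def
  proof (intro ballI, rule ccontr)
    fix a assume a: "a \<in> C" "\<not> (a \<in> set R \<or> against vs c a \<noteq> 0)"
    have "c \<in> C" using Q assms(4) by auto
    have "a \<noteq> c"
      using a assms(1,2) bef_refl[of a "hd vs"] by (auto simp: against_eq_0_iff)
    then have "a \<in> set ps" using a Q assms(4) by auto
    then obtain us xs where ps: "ps = us @ a # xs" by (meson split_list)
    have "list_cost vs (us @ c # xs @ a # R) < list_cost vs (us @ a # xs @ c # R)"
      using a by (intro list_cost_swap_less[OF assms(1,2) \<open>c \<in> C\<close>]) auto
    moreover have "list_cost vs (us @ a # xs @ c # R) \<le> list_cost vs (us @ c # xs @ a # R)"
      using assms(5)[of "us @ c # xs @ a # R"] assms(3,4) unfolding Q ps by auto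
    ultimately show False by simp
  qed
qed (use assms in auto)

lemma ex_feasible_optimal:
  assumes "finite C" "\<forall>v\<in>set vs. set v = C" "vs \<noteq> []"
  obtains Q where "feasible vs C Q" "set Q = C"
    "\<And>Q'. distinct Q' \<Longrightarrow> set Q' = C \<Longrightarrow> list_cost vs Q \<le> list_cost vs Q'"
proof -
  obtain xs where xs: "distinct xs" "set xs = C" using finite_distinct_list[OF assms(1)] by blast
  define Q where "Q = arg_min (list_cost vs) (\<lambda>Q. distinct Q \<and> set Q = C)"
  have Q: "distinct Q \<and> set Q = C"
    unfolding Q_def by (rule arg_min_natI[of _ xs]) (use xs in simp)
  have le: "list_cost vs Q \<le> list_cost vs Q'" if "distinct Q'" "set Q' = C" for Q'
    unfolding Q_def by (rule arg_min_nat_le) (use that in simp)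
  show thesis using that optimal_list_feasible[OF assms(2,3), of Q] Q le by blast
qed

lemma kemeny_rankings_eq:
  assumes "finite C" "\<forall>v\<in>set vs. distinct v \<and> set v = C" "vs \<noteq> []"
    and k: "\<And>Q. feasible vs C Q \<Longrightarrow> set Q = C \<Longrightarrow> k \<le> list_cost vs Q"
    and ex: "\<exists>Q. feasible vs C Q \<and> set Q = C \<and> list_cost vs Q = k"
  shows "kemeny_rankings C (mset (map order_of_list vs)) =
    order_of_list ` {Q. feasible vs C Q \<and> set Q = C \<and> list_cost vs Q = k}"
proof -
  let ?score = "kemeny_score C (mset (map order_of_list vs))"
  have vs: "\<forall>v\<in>set vs. set v = C" using assms(2) by simp
  have score: "?score (order_of_list Q) = list_cost vs Q" if "distinct Q" "set Q = C" for Q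
    using kemeny_score_eq_list_cost[OF that assms(2)] .
  have opt: "feasible vs C Q" if "distinct Q" "set Q = C"
    "\<And>Q'. distinct Q' \<Longrightarrow> set Q' = C \<Longrightarrow> list_cost vs Q \<le> list_cost vs Q'" for Q
    using optimal_list_feasible[OF vs assms(3)] that by blast
  have ge: "k \<le> list_cost vs Q" if Q: "distinct Q" "set Q = C" for Q
    by (rule ex_feasible_optimal[OF assms(1) vs assms(3)]) (use k Q le_trans in blast)
  obtain Q1 where Q1: "feasible vs C Q1" "set Q1 = C" "list_cost vs Q1 = k" using ex by blast
  have Q1': "distinct Q1" using feasible_distinct[OF Q1(1)] by simp
  show ?thesis
  proof (intro set_eqI iffI)
    fix \<pi> assume "\<pi> \<in> kemeny_rankings C (mset (map order_of_list vs))"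
    then have lin: "linear_order_on C \<pi>"
      and min: "\<And>\<sigma>. linear_order_on C \<sigma> \<Longrightarrow> ?score \<pi> \<le> ?score \<sigma>"
      by (auto simp: kemeny_rankings_def is_arg_min_linorder)
    obtain Q where Q: "distinct Q" "set Q = C" "order_of_list Q = \<pi>"
      using ranking_has_list[OF assms(1) lin] by blast
    have le: "list_cost vs Q \<le> list_cost vs Q'" if "distinct Q'" "set Q' = C" for Q'
      using min[of "order_of_list Q'"] linear_order_on_order_of_list[OF that(1)] that Q score by auto
    have "feasible vs C Q" using opt[OF Q(1,2) le] .
    moreover have "list_cost vs Q = k" using le[OF Q1' Q1(2)] Q1(3) ge[OF Q(1,2)] by simp
    ultimately show "\<pi> \<in> order_of_list ` {Q. feasible vs C Q \<and> set Q = C \<and> list_cost vs Q = k}"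
      using Q by blast
  next
    fix \<pi> assume "\<pi> \<in> order_of_list ` {Q. feasible vs C Q \<and> set Q = C \<and> list_cost vs Q = k}"
    then obtain Q where Q: "feasible vs C Q" "set Q = C" "list_cost vs Q = k" "\<pi> = order_of_list Q"
      by blast
    have dQ: "distinct Q" using feasible_distinct[OF Q(1)] by simp
    have "?score \<pi> \<le> ?score \<sigma>" if lin: "linear_order_on C \<sigma>" for \<sigma>
    proof -
      obtain R where "distinct R" "set R = C" "order_of_list R = \<sigma>"
        using ranking_has_list[OF assms(1) lin] by blast
      then show ?thesis using ge[of R] score Q dQ by auto
    qed
    moreover have "linear_order_on C \<pi>"
      using linear_order_on_order_of_list[OF dQ] Q by simp
    ultimately show "\<pi> \<in> kemeny_rankings C (mset (map order_of_list vs))"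
      by (simp add: kemeny_rankings_def is_arg_min_linorder)
  qed
qed

section \<open>Counting the bottom sets\<close>

lemma pos_diff_less_max_range:
  assumes "election C \<Pi>" "c \<in> C" "\<pi> \<in># \<Pi>" "\<sigma> \<in># \<Pi>"
  shows "pos C \<pi> c < pos C \<sigma> c + max_range C \<Pi>"
proof -
  let ?D = "{nat \<bar>int (pos C \<pi> c) - int (pos C \<sigma> c)\<bar> | \<pi> \<sigma>. \<pi> \<in># \<Pi> \<and> \<sigma> \<in># \<Pi>}"
  have "?D = (\<lambda>(\<pi>, \<sigma>). nat \<bar>int (pos C \<pi> c) - int (pos C \<sigma> c)\<bar>) ` (set_mset \<Pi> \<times> set_mset \<Pi>)"
    by auto
  then have "finite ?D" by simp
  then have "nat \<bar>int (pos C \<pi> c) - int (pos C \<sigma> c)\<bar> \<le> Max ?D"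
    using assms(3,4) by (intro Max_ge) auto
  also have "\<dots> < cand_range C \<Pi> c" by (simp add: cand_range_def)
  also have "\<dots> \<le> max_range C \<Pi>"
    unfolding max_range_def using assms(1,2) by (intro Max_ge) (auto simp: election_def)
  finally show ?thesis by linarith
qed

lemma pos_nth:
  assumes "distinct v" "i < length v"
  shows "pos (set v) (order_of_list v) (v ! i) = i"
proof -
  have "{c' \<in> set v. above (order_of_list v) c' (v ! i)} = set (take i v)"
  proof (intro set_eqI iffI)
    fix x assume "x \<in> {c' \<in> set v. above (order_of_list v) c' (v ! i)}"
    then obtain l j where lj: "x = v ! l" "v ! i = v ! j" "l \<le> j" "j < length v" "x \<noteq> v ! i"
      by (auto simp: above_def order_of_list_def)
    have "j = i" using nth_eq_iff_index_eq[OF assms lj(4)] lj(2) by simp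
    moreover have "l \<noteq> i" using lj(1,5) by auto
    ultimately have "l < i" using lj(3) by simp
    then show "x \<in> set (take i v)" unfolding lj(1) using assms(2) by (auto simp: in_set_conv_nth)
  next
    fix x assume "x \<in> set (take i v)"
    then obtain l where l: "l < i" "x = v ! l" using assms(2) by (auto simp: in_set_conv_nth)
    then have "(x, v ! i) \<in> order_of_list v"
      unfolding order_of_list_def using assms(2) less_imp_le by blast
    then show "x \<in> {c' \<in> set v. above (order_of_list v) c' (v ! i)}"
      using l assms by (auto simp: above_def nth_eq_iff_index_eq)
  qed
  then show ?thesis using assms by (simp add: pos_def distinct_card)
qed

lemma bef_imp_pos_le:
  assumes "distinct v" "bef b a v" "a \<in> set v" "b \<in> set v"
  shows "pos (set v) (order_of_list v) b \<le> pos (set v) (order_of_list v) a"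
proof (cases "a = b")
  case False
  then have "above (order_of_list v) b a" using assms above_order_of_list_iff_bef[of v b a] by simp
  moreover have "trans (order_of_list v)" "antisym (order_of_list v)"
    using linear_order_on_order_of_list[OF assms(1)] by (auto simp: order_on_defs)
  ultimately have "{c \<in> set v. above (order_of_list v) c b} \<subseteq> {c \<in> set v. above (order_of_list v) c a}"
    unfolding above_def by (blast dest: transD antisymD)
  then show ?thesis unfolding pos_def by (intro card_mono) auto
qed simp

lemma against_far_apart:
  assumes "election C (mset (map order_of_list vs))" "\<forall>v\<in>set vs. distinct v \<and> set v = C"
    "v \<in> set vs" "i + 2 * max_range C (mset (map order_of_list vs)) \<le> j" "j < length v"
  shows "against vs (v ! i) (v ! j) = 0"
  unfolding against_eq_0_iff
proof (intro ballI notI)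
  fix w assume w: "w \<in> set vs" "bef (v ! j) (v ! i) w"
  let ?\<Pi> = "mset (map order_of_list vs)"
  let ?R = "max_range C ?\<Pi>"
  have v: "distinct v" "set v = C" and w': "distinct w" "set w = C" using assms(2,3) w by auto
  have C: "v ! i \<in> C" "v ! j \<in> C" using assms(4,5) v nth_mem[of i v] nth_mem[of j v] by auto
  have in_\<Pi>: "order_of_list v \<in># ?\<Pi>" "order_of_list w \<in># ?\<Pi>" using assms(3) w by auto
  have "pos C (order_of_list w) (v ! j) \<le> pos C (order_of_list w) (v ! i)"
    using bef_imp_pos_le[OF w'(1) w(2)] C w' by simp
  moreover have "pos C (order_of_list w) (v ! i) < i + ?R"
    using pos_diff_less_max_range[OF assms(1) C(1) in_\<Pi>(2,1)] pos_nth[OF v(1), of i] v(2) assms(4,5)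
    by simp
  moreover have "j < pos C (order_of_list w) (v ! j) + ?R"
    using pos_diff_less_max_range[OF assms(1) C(2) in_\<Pi>] pos_nth[OF v(1), of j] v(2) assms(5)
    by simp
  ultimately show False using assms(4) by simp
qed

lemma feasible_upset:
  assumes "feasible vs C Q" "c \<in> set Q" "a \<in> C" "against vs c a = 0"
  shows "a \<in> set Q"
  using assms by (induction Q) (auto simp: admissible_def)

lemma card_bottom_sets_le:
  assumes "election C (mset (map order_of_list vs))" "\<forall>v\<in>set vs. distinct v \<and> set v = C"
  shows "finite (set ` {Q. feasible vs C Q})"
    "card (set ` {Q. feasible vs C Q}) \<le> (card C + 1) * 4 ^ max_range C (mset (map order_of_list vs))"
proof -
  let ?R = "max_range C (mset (map order_of_list vs))"
  obtain v where v: "v \<in> set vs" using assms(1) by (cases vs) (auto simp: election_def)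
  then have dv: "distinct v" "set v = C" using assms(2) by auto
  define W where "W m = (\<lambda>Y. Y \<union> set (drop (m + 2 * ?R) v)) ` Pow (set (take (2 * ?R) (drop m v)))" for m
  have fW: "finite (W m)" for m by (simp add: W_def)
  have cW: "card (W m) \<le> 4 ^ ?R" for m
  proof -
    have "card (W m) \<le> card (Pow (set (take (2 * ?R) (drop m v))))"
      unfolding W_def by (rule card_image_le) simp
    also have "\<dots> = 2 ^ card (set (take (2 * ?R) (drop m v)))" by (simp add: card_Pow)
    also have "\<dots> \<le> 2 ^ (2 * ?R)"
      by (rule power_increasing) (use card_length[of "take (2 * ?R) (drop m v)"] in auto)
    finally show ?thesis by (simp add: power_mult)
  qed
  have sub: "set ` {Q. feasible vs C Q} \<subseteq> (\<Union>m\<le>length v. W m)"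
  proof
    fix X assume "X \<in> set ` {Q. feasible vs C Q}"
    then obtain Q where Q: "X = set Q" "feasible vs C Q" by blast
    have XC: "X \<subseteq> C" using feasible_distinct[OF Q(2)] Q(1) by simp
    have "\<exists>m\<le>length v. X \<subseteq> set (drop m v) \<and> set (drop (m + 2 * ?R) v) \<subseteq> X"
    proof (cases "X = {}")
      case True
      then show ?thesis by (intro exI[of _ "length v"]) simp
    next
      case False
      then obtain x where "x \<in> X" by blast
      then obtain i where i: "i < length v" "v ! i \<in> X" using XC dv by (metis in_set_conv_nth subsetD)
      define m where "m = (LEAST i. i < length v \<and> v ! i \<in> X)"
      have m: "m < length v" "v ! m \<in> X" using LeastI[of "\<lambda>i. i < length v \<and> v ! i \<in> X" i] i by (auto simp: m_def)
      have least: "m \<le> j" if "j < length v" "v ! j \<in> X" for j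
        unfolding m_def using that by (intro Least_le) simp
      have "X \<subseteq> set (drop m v)"
      proof
        fix y assume "y \<in> X"
        then obtain j where j: "j < length v" "y = v ! j" using XC dv by (metis in_set_conv_nth subsetD)
        then have "m \<le> j" using least \<open>y \<in> X\<close> by simp
        then have "drop m v ! (j - m) = y" "j - m < length (drop m v)" using j by auto
        then show "y \<in> set (drop m v)" by (metis nth_mem)
      qed
      moreover have "set (drop (m + 2 * ?R) v) \<subseteq> X"
      proof
        fix y assume "y \<in> set (drop (m + 2 * ?R) v)"
        then obtain j where "j < length (drop (m + 2 * ?R) v)" "y = drop (m + 2 * ?R) v ! j"
          by (metis in_set_conv_nth)
        then have j: "m + 2 * ?R + j < length v" "y = v ! (m + 2 * ?R + j)" by auto
        have "against vs (v ! m) y = 0"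
          unfolding j(2) using j(1) by (intro against_far_apart[OF assms v]) auto
        moreover have "y \<in> C" using j dv nth_mem by blast
        ultimately show "y \<in> X" using feasible_upset[OF Q(2)] m(2) Q(1) by blast
      qed
      ultimately show ?thesis using m(1) by (intro exI[of _ m]) simp
    qed
    then obtain m where m: "m \<le> length v" "X \<subseteq> set (drop m v)" "set (drop (m + 2 * ?R) v) \<subseteq> X" by blast
    have "set (drop m v) = set (take (2 * ?R) (drop m v)) \<union> set (drop (m + 2 * ?R) v)"
      by (metis append_take_drop_id drop_drop add.commute set_append)
    then have "X = (X \<inter> set (take (2 * ?R) (drop m v))) \<union> set (drop (m + 2 * ?R) v)"
      using m by blast
    then have "X \<in> W m" unfolding W_def by (intro image_eqI) auto
    then show "X \<in> (\<Union>m\<le>length v. W m)" using m(1) by blast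
  qed
  have fin: "finite (\<Union>m\<le>length v. W m)" using fW by simp
  show "finite (set ` {Q. feasible vs C Q})" using finite_subset[OF sub fin] .
  have "card (set ` {Q. feasible vs C Q}) \<le> card (\<Union>m\<le>length v. W m)"
    using sub fin by (rule card_mono[rotated])
  also have "\<dots> \<le> (\<Sum>m\<le>length v. card (W m))" by (rule card_UN_le) simp
  also have "\<dots> \<le> (\<Sum>m\<le>length v. 4 ^ ?R)" by (rule sum_mono) (rule cW)
  also have "\<dots> = (card C + 1) * 4 ^ ?R" using dv distinct_card[of v] by simp
  finally show "card (set ` {Q. feasible vs C Q}) \<le> (card C + 1) * 4 ^ ?R" .
qed

section \<open>Running time\<close>

lemma expand_time_scale: "1 \<le> E \<Longrightarrow> expand_time z (M * E) \<le> E * expand_time z M"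
  for E :: nat
proof -
  assume E: "1 \<le> E"
  define a where "a = z * 30 + z * (z * (50 * z + 50) + 30) + z * (z * (50 * z + 20) + 20) + z * 30 + 100"
  have eq: "expand_time z K = a + (K + 1) * ins_time z" for K
    by (simp add: expand_time_def a_def)
  have "a \<le> E * a" "M * E + 1 \<le> E * (M + 1)" using E by (simp_all add: algebra_simps)
  then have "a + (M * E + 1) * ins_time z \<le> E * a + E * (M + 1) * ins_time z"
    by (intro add_le_mono mult_le_mono1)
  then show ?thesis unfolding eq by (simp add: algebra_simps)
qed

lemma step_time_scale: "1 \<le> E \<Longrightarrow> step_time z (N * E) \<le> E * E * step_time z N"
  for E :: nat
proof -
  assume E: "1 \<le> E"
  have "expand_time z (N * E * z) \<le> E * expand_time z (N * z)"
    using expand_time_scale[OF E, of z "N * z"] by (simp add: mult_ac)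
  then have "z * expand_time z (N * E * z) + 40 \<le> z * (E * expand_time z (N * z)) + E * 40"
    using E by (intro add_le_mono mult_le_mono2) auto
  also have "\<dots> = E * (z * expand_time z (N * z) + 40)" by (simp add: algebra_simps)
  finally have "(N * E + 1) * (z * expand_time z (N * E * z) + 40)
      \<le> (E * (N + 1)) * (E * (z * expand_time z (N * z) + 40))"
    using E by (intro mult_le_mono) (auto simp: algebra_simps)
  then show ?thesis unfolding step_time_def by (simp only: mult_ac)
qed

definition total_time :: "nat \<Rightarrow> nat" where
  "total_time z = z * (step_time z z + 40) + z * 30 + 60"

lemma total_time_scale:
  fixes E :: nat
  assumes "1 \<le> E"
  shows "z * (step_time z (z * E) + 40) + z * 30 + 60 \<le> E * E * total_time z"
proof -
  have E: "1 \<le> E * E" using assms by (simp add: mult_le_mono)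
  have "z * (step_time z (z * E) + 40) + z * 30 + 60 \<le>
      z * (E * E * step_time z z + E * E * 40) + E * E * (z * 30) + E * E * 60"
    using E step_time_scale[OF assms, of z z] by (intro add_le_mono mult_le_mono2) auto
  also have "\<dots> = E * E * total_time z" by (simp add: total_time_def algebra_simps)
  finally show ?thesis .
qed

definition polynomial_fun :: "(nat \<Rightarrow> nat) \<Rightarrow> bool" where
  "polynomial_fun f \<longleftrightarrow> (\<exists>p. \<forall>x. poly p x = f x)"

lemma polynomial_fun_const: "polynomial_fun (\<lambda>_. c)"
  unfolding polynomial_fun_def by (rule exI[of _ "[:c:]"]) simp

lemma polynomial_fun_id: "polynomial_fun (\<lambda>x. x)"
  unfolding polynomial_fun_def by (rule exI[of _ "[:0, 1:]"]) simp

lemma polynomial_fun_add: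
  "polynomial_fun f \<Longrightarrow> polynomial_fun g \<Longrightarrow> polynomial_fun (\<lambda>x. f x + g x)"
  unfolding polynomial_fun_def by (metis poly_add)

lemma polynomial_fun_mult:
  "polynomial_fun f \<Longrightarrow> polynomial_fun g \<Longrightarrow> polynomial_fun (\<lambda>x. f x * g x)"
  unfolding polynomial_fun_def by (metis poly_mult)

lemma polynomial_fun_total_time: "polynomial_fun (\<lambda>x. total_time (x + 2))"
  unfolding total_time_def step_time_def expand_time_def ins_time_def
  by (intro polynomial_fun_add polynomial_fun_mult polynomial_fun_const polynomial_fun_id)

lemma length_less_val_size_enc_list: "length xs < val_size (enc_list f xs)"
  by (induction xs) auto

lemma val_size_mem_le: "x \<in> set xs \<Longrightarrow> val_size (f x) \<le> val_size (enc_list f xs)"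
  by (induction xs) auto

lemma length_layer_le:
  assumes "table vs r (feasible_of_length vs C i) L"
    "election C (mset (map order_of_list vs))" "\<forall>v\<in>set vs. distinct v \<and> set v = C"
  shows "length L \<le> (card C + 1) * 4 ^ max_range C (mset (map order_of_list vs))"
proof -
  have "distinct (map (set \<circ> fst) L)" and img: "(set \<circ> fst) ` set L = set ` feasible_of_length vs C i"
    using assms(1) by (simp_all add: table_def)
  then have "length L = card (set (map (set \<circ> fst) L))" using distinct_card by fastforce
  also have "\<dots> = card (set ` feasible_of_length vs C i)" by (simp only: set_map img)
  also have "\<dots> \<le> card (set ` {Q. feasible vs C Q})"
    by (rule card_mono[OF card_bottom_sets_le(1)[OF assms(2,3)]]) (auto simp: feasible_of_length_def)
  also note card_bottom_sets_le(2)[OF assms(2,3)]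
  finally show ?thesis .
qed

lemma final_layer_solution:
  assumes "distinct cs" "set cs = C" "\<forall>v\<in>set vs. distinct v \<and> set v = C" "vs \<noteq> []"
  obtains S k Qs L where "layers r cs vs (length cs) (initial_layer r) = (S, k, Qs) # L"
    "encodes_solution C (mset (map order_of_list vs)) r (enc_list enc_ranking Qs)"
proof -
  let ?L = "layers r cs vs (length cs) (initial_layer r)"
  let ?A = "feasible_of_length vs C (length cs)"
  have tab: "table vs r ?A ?L" using table_layers[OF assms(1)] assms(2) by simp
  have fin: "finite C" and card: "card C = length cs" using assms(1,2) distinct_card by auto
  have vs: "\<forall>v\<in>set vs. set v = C" using assms(3) by simp
  obtain Q0 where Q0: "feasible vs C Q0" "set Q0 = C"
    by (rule ex_feasible_optimal[OF fin vs assms(4)], rule that)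
  have "Q0 \<in> ?A"
    using Q0 feasible_distinct[OF Q0(1)] distinct_card[of Q0] card by (simp add: feasible_of_length_def)
  have img: "(set \<circ> fst) ` set ?L = set ` ?A"
    and ent: "\<forall>(S, k, Qs)\<in>set ?L. distinct S \<and> best (list_cost vs) r {Q \<in> ?A. set Q = set S} k Qs"
    using tab unfolding table_def by simp_all
  from \<open>Q0 \<in> ?A\<close> img have "?L \<noteq> []" by auto
  then obtain e L where "?L = e # L" by (meson neq_Nil_conv)
  moreover obtain S k Qs where "e = (S, k, Qs)" by (cases e)
  ultimately have L: "?L = (S, k, Qs) # L" by simp
  have mem: "(S, k, Qs) \<in> set ?L" unfolding L by simp
  have S: "distinct S" "best (list_cost vs) r {Q \<in> ?A. set Q = set S} k Qs"
    using bspec[OF ent mem] by simp_all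
  have len: "length S = length cs" using table_entry_length[OF tab mem] .
  have "set S \<in> set ` ?A" unfolding img[symmetric] using mem by (rule rev_image_eqI) simp
  then obtain Q where "set S = set Q" "feasible vs C Q" by (auto simp: feasible_of_length_def)
  then have "set S \<subseteq> C" using feasible_distinct[of vs C Q] by simp
  then have SC: "set S = C"
    using fin card len distinct_card[OF S(1)] by (intro card_subset_eq) auto
  let ?F = "{Q. feasible vs C Q \<and> set Q = C}"
  have best: "best (list_cost vs) r ?F k Qs"
    using S(2)[unfolded feasible_fiber[OF S(1) len]] unfolding SC .
  let ?O = "{Q. feasible vs C Q \<and> set Q = C \<and> list_cost vs Q = k}"
  have O: "{Q \<in> ?F. list_cost vs Q = k} = ?O" by auto
  have K: "kemeny_rankings C (mset (map order_of_list vs)) = order_of_list ` ?O"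
    using best by (intro kemeny_rankings_eq[OF fin assms(3,4)]) (auto simp: best_def)
  have inj: "inj_on order_of_list ?O"
    using order_of_list_inject feasible_distinct by (intro inj_onI) blast
  have Qs: "distinct Qs" "set Qs \<subseteq> ?O" "length Qs = min r (card ?O)"
    using best unfolding best_def O by auto
  have "encodes_solution C (mset (map order_of_list vs)) r (enc_list enc_ranking Qs)"
    unfolding encodes_solution_def K
  proof (intro exI[of _ Qs] conjI)
    show "\<forall>w\<in>set Qs. distinct w \<and> set w = C" using Qs(2) feasible_distinct by blast
    show "distinct (map order_of_list Qs)"
      using Qs(1) inj_on_subset[OF inj Qs(2)] by (simp add: distinct_map)
    show "length Qs = min r (card (order_of_list ` ?O))"
      unfolding card_image[OF inj] by (rule Qs(3))
  qed (use Qs(2) in auto)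
  with L show thesis by (rule that)
qed

theorem theorem4:
  shows "\<exists>(P :: program) (p :: nat poly).
    \<forall>(C :: nat set) (\<Pi> :: nat rel multiset) (r :: nat) (inp :: val).
      election C \<Pi> \<and> encodes_instance C \<Pi> r inp \<longrightarrow>
      (\<exists>out t. runs P inp out t \<and> encodes_solution C \<Pi> r out \<and>
         t \<le> 32 ^ max_range C \<Pi> * poly p (val_size inp))"
proof -
  obtain p where p: "\<And>x. poly p x = total_time (x + 2)"
    using polynomial_fun_total_time unfolding polynomial_fun_def by blast
  have "\<exists>out t. runs kemeny_prog inp out t \<and> encodes_solution C \<Pi> r out \<and>
      t \<le> 32 ^ max_range C \<Pi> * poly p (val_size inp)"
    if el: "election C \<Pi>" and enc: "encodes_instance C \<Pi> r inp" for C \<Pi> r inp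
  proof -
    from enc obtain cs vs where cs: "distinct cs" "set cs = C"
      and vs: "\<forall>v\<in>set vs. distinct v \<and> set v = C" and \<Pi>: "\<Pi> = mset (map order_of_list vs)"
      and inp: "inp = Cell (enc_ranking cs)
        (Cell (enc_list enc_ranking vs) (enc_list Num (replicate r 0)))"
      unfolding encodes_instance_def by blast
    have ne: "vs \<noteq> []" using el \<Pi> by (auto simp: election_def)
    have el': "election C (mset (map order_of_list vs))" using el \<Pi> by simp
    have card: "card C = length cs" using cs distinct_card by blast
    define z where "z = val_size inp + 2"
    define E :: nat where "E = 4 ^ max_range C \<Pi>"
    have lcs: "length cs + 2 \<le> z"
      using length_less_val_size_enc_list[of cs Num] by (simp add: z_def inp enc_ranking_def)
    have lr: "r + 1 \<le> z"
      using length_less_val_size_enc_list[of "replicate r 0" Num] by (simp add: z_def inp)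
    have lvs: "length vs + 1 \<le> z"
      using length_less_val_size_enc_list[of vs enc_ranking] by (simp add: z_def inp)
    have lv: "length v + 1 \<le> z" if "v \<in> set vs" for v
      using length_less_val_size_enc_list[of v Num] val_size_mem_le[OF that, of enc_ranking]
      by (simp add: z_def inp enc_ranking_def)
    have bounds: "layer_bounds z r cs vs"
      using lcs lr lvs lv by (simp add: layer_bounds_def)
    have tab: "table vs r (feasible_of_length vs C i) (layers r cs vs i (initial_layer r))" for i
      using table_layers[OF cs(1)] cs(2) by simp
    have len: "length (layers r cs vs i (initial_layer r)) \<le> z * E" for i
    proof -
      have "length (layers r cs vs i (initial_layer r)) \<le> (card C + 1) * E"
        using length_layer_le[OF tab el' vs] by (simp add: E_def \<Pi>)
      also have "\<dots> \<le> z * E" using lcs card by (intro mult_le_mono1) simp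
      finally show ?thesis .
    qed
    have fits: "fits z e" if "i < length cs" "e \<in> set (layers r cs vs i (initial_layer r))" for i e
    proof -
      obtain S k Qs where e: "e = (S, k, Qs)" by (cases e)
      have "length S = i" using table_entry_length[OF tab] that(2) e by blast
      moreover have "length Qs \<le> r" using tab[of i] that(2) e by (auto simp: table_def best_def)
      ultimately show ?thesis using that(1) lcs lr e by (simp add: fits_def)
    qed
    obtain S k Qs L where fin: "layers r cs vs (length cs) (initial_layer r) = (S, k, Qs) # L"
      and sol: "encodes_solution C (mset (map order_of_list vs)) r (enc_list enc_ranking Qs)"
      using final_layer_solution[OF cs vs ne] by blast
    have "\<exists>t \<le> z * (step_time z (z * E) + 40) + z * 30 + 60.
        runs kemeny_prog inp (enc_list enc_ranking Qs) t"
      unfolding inp by (rule runs_kemeny_prog[OF bounds len _ fin]) (rule fits)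
    then obtain t where t: "t \<le> z * (step_time z (z * E) + 40) + z * 30 + 60"
      and run: "runs kemeny_prog inp (enc_list enc_ranking Qs) t" by blast
    have "E * E = 16 ^ max_range C \<Pi>" by (simp add: E_def flip: power_mult_distrib)
    also have "\<dots> \<le> 32 ^ max_range C \<Pi>" by (rule power_mono) auto
    finally have "E * E * total_time z \<le> 32 ^ max_range C \<Pi> * poly p (val_size inp)"
      unfolding p z_def[symmetric] by (rule mult_le_mono1)
    moreover have "t \<le> E * E * total_time z"
      using t total_time_scale[of E z] by (simp add: E_def)
    ultimately have "t \<le> 32 ^ max_range C \<Pi> * poly p (val_size inp)" by simp
    then show ?thesis using run sol \<Pi> by blast
  qed
  then show ?thesis by blast
qed

end
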